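(* There exists an absolute constant $c>0$ such that for all integers $N\ge3$ and $g\ge1$, if $A\subseteq\{1^4,2^4,\ldots,N^4\}$ is a $B_4[g]$-set, then $$|A|\ll\frac{g^{1/16}N}{(\log\log N)^{c}}.$$
   Context: For an integer $h\ge2$ and a set $A$ of integers, $R_{A,h}(m)$ is the number of tuples $(a_1,\ldots,a_h)\in A^h$ with $a_1\le a_2\le\cdots\le a_h$ and $a_1+\cdots+a_h=m$. $A$ is a $B_h[g]$-set if $R_{A,h}(m)\le g$ for all integers $m$. $X\ll Y$ means $X\le CY$ for an absolute constant $C>0$. *)

theory Defs
  imports Complex_Main
begin

definition rep_tuples :: "int set \<Rightarrow> nat \<Rightarrow> int \<Rightarrow> int list set" where
  "rep_tuples A h m = {as. length as = h \<and> set as \<subseteq> A \<and> sorted as \<and> sum_list as = m}"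

definition rep_count :: "int set \<Rightarrow> nat \<Rightarrow> int \<Rightarrow> nat" where
  "rep_count A h m = card (rep_tuples A h m)"

text \<open>The finiteness clause is needed because an infinite set has \<^const>\<open>card\<close> 0: for an infinite
  \<open>A\<close>, an integer with infinitely many representations must violate the bound.\<close>

definition is_B_set :: "nat \<Rightarrow> nat \<Rightarrow> int set \<Rightarrow> bool" where
  "is_B_set h g A \<longleftrightarrow> (\<forall>m. finite (rep_tuples A h m) \<and> rep_count A h m \<le> g)"

end

theory Submission
  imports Defs
    "HOL-Analysis.Analysis"
    "HOL-Number_Theory.Number_Theory"
    "HOL-Computational_Algebra.Squarefree"
    "HOL-Combinatorics.Multiset_Permutations"
begin

text \<open>
  Let \<open>X \<subseteq> {1..N}\<close> be the set of bases of the given fourth powers and let \<open>\<delta> = card X / N\<close>.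
  Fix a set \<open>B\<close> of \<open>L\<close> large primes, put \<open>D = \<Prod>B\<close>, and count the quadruples in \<open>X\<close> whose
  sum of fourth powers is a multiple of \<open>D ^ 4\<close>.

  There are at most \<open>4 * N ^ 4 / D ^ 4\<close> such sums, and each of them has at most \<open>24 * g\<close> ordered
  representations, so there are at most \<open>96 * g * N ^ 4 / D ^ 4\<close> quadruples
  (\<open>card_divisible_quadruples_le\<close>).

  For the lower bound choose \<open>p \<in> B\<close> and look at quadruples all of whose entries are divisible by \<open>p\<close>
  and by no other prime of \<open>B\<close>. The factor \<open>p ^ 4\<close> of the sum comes for free, at the price of a
  factor \<open>p ^ -4\<close> in the number of quadruples. Since the number of variables equals the degree, the
  two effects cancel: each \<open>p\<close> yields about \<open>card X ^ 4 / D ^ 4\<close> quadruples, whatever its size. The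
  quadruples for different \<open>p\<close> are different, so altogether \<open>L * \<delta> ^ 4\<close> is at most a constant times
  \<open>g\<close>, and a suitable choice of \<open>L\<close> is contradictory (\<open>block_length_le\<close>).

  The heuristic number of quadruples is correct when \<open>X\<close> is equidistributed modulo \<open>D ^ 4\<close>, for two
  reasons. First, the equation has the expected number of solutions in the units modulo each
  \<open>q ^ 4\<close>: modulo \<open>q\<close> this follows from a square-root bound for quartic exponential sums
  (\<open>norm_quartic_sum_le\<close>), it is lifted to \<open>q ^ 4\<close> by Hensel's argument (\<open>card_unit_solutions\<close>), and
  the Chinese remainder theorem combines the primes (\<open>card_completions_bounds\<close>). Secondly, the bounds
  are uniform after one coordinate has been fixed, so that few exceptional residue classes spoil
  few solutions (\<open>card_admissible_quadruples\<close>).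

  Equidistribution is measured by a normalised variance, the \<open>defect\<close>. As the residue class of zero
  modulo \<open>p\<close> has proportion \<open>1 / p\<close> only, a defect of at most a constant times \<open>1 / p\<close> for all
  \<open>p \<in> B\<close> is needed. The defects for pairwise coprime moduli add up to at most \<open>3 / \<delta>\<close>, by Bessel's
  inequality (\<open>sum_defect_le\<close>). Cut the primes up to \<open>y\<close> into blocks of \<open>L\<close> consecutive ones. If each
  block had too large a defect, then the sum of the reciprocals of the primes up to \<open>y\<close> would be
  bounded by a multiple of \<open>L / \<delta>\<close>; but this sum grows like \<open>ln (ln y)\<close>
  (\<open>exists_equidistributed_block\<close>). This is where the iterated logarithm comes from.
  With \<open>N\<close> at least a power of \<open>y\<close> one obtains that \<open>ln (ln N)\<close> is at most a constant times
  \<open>(g / \<delta> ^ 4) ^ 2\<close> (\<open>ln_ln_le_density_power\<close>). Together with \<open>\<delta> \<le> 1\<close> this gives the theorem.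
\<close>

section \<open>Quartic exponential sums modulo a prime\<close>

definition add_char :: "nat \<Rightarrow> nat \<Rightarrow> complex" where
  "add_char q k = cis (2 * pi * real k / real q)"

lemma add_char_add: "add_char q (a + b) = add_char q a * add_char q b"
  unfolding add_char_def by (simp add: cis_mult distrib_left add_divide_distrib)

lemma norm_add_char [simp]: "norm (add_char q k) = 1"
  unfolding add_char_def by simp

lemma add_char_0 [simp]: "add_char q 0 = 1"
  unfolding add_char_def by simp

lemma add_char_multiple [simp]: "q > 0 \<Longrightarrow> add_char q (q * k) = 1"
  unfolding add_char_def using cis_multiple_2pi[of "real k"] by (simp add: mult_ac)

lemma add_char_power: "add_char q (h * k) = add_char q k ^ h"
  by (induction h) (simp_all add: add_char_add)

lemma add_char_mod: "q > 0 \<Longrightarrow> add_char q (k mod q) = add_char q k"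
  using add_char_add[of q "q * (k div q)" "k mod q"] by simp

lemma add_char_cong:
  assumes "q > 0" "[a = b] (mod q)"
  shows "add_char q a = add_char q b"
  using add_char_mod[OF assms(1), of a] add_char_mod[OF assms(1), of b] assms(2)
  by (simp add: cong_def)

lemma add_char_eq_1_iff:
  assumes "q > 0"
  shows "add_char q k = 1 \<longleftrightarrow> q dvd k"
proof
  assume "add_char q k = 1"
  then have "cos (2 * pi * real k / real q) = 1"
    unfolding add_char_def by (metis cis.simps(1) one_complex.simps(1))
  then obtain n :: int where n: "2 * pi * real k / real q = real_of_int n * (2 * pi)"
    unfolding cos_one_2pi_int by (auto simp: mult_ac)
  then have "real k = real_of_int n * real q"
    using assms by (simp add: field_simps)
  then have "real_of_int (int k) = real_of_int (n * int q)" by simp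
  then have "int k = n * int q" by (simp only: of_int_eq_iff)
  then show "q dvd k" by (metis dvd_triv_right int_dvd_int_iff)
qed (auto simp: assms elim!: dvdE)

lemma sum_add_char:
  assumes "q > 0"
  shows "(\<Sum>h<q. add_char q (h * k)) = (if q dvd k then of_nat q else 0)"
proof (cases "q dvd k")
  case True
  then have "add_char q (h * k) = 1" for h
    using assms by (simp add: add_char_eq_1_iff)
  then show ?thesis using True by simp
next
  case False
  have "add_char q k ^ q = 1"
    using assms by (simp flip: add_char_power)
  then have "(\<Sum>h<q. add_char q k ^ h) = 0"
    using False assms by (subst geometric_sum) (auto simp: add_char_eq_1_iff)
  then show ?thesis using False by (simp add: add_char_power)
qed

lemma cnj_add_char:
  assumes "q > 0"
  shows "cnj (add_char q a) = add_char q ((q - 1) * a)"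
proof -
  have "add_char q a * add_char q ((q - 1) * a) = add_char q (a + (q - 1) * a)"
    by (simp add: add_char_add)
  also have "a + (q - 1) * a = q * a"
    using assms by (cases q) auto
  finally have "add_char q a * add_char q ((q - 1) * a) = 1"
    using assms by simp
  moreover have "add_char q a * cnj (add_char q a) = 1"
    by (simp add: complex_norm_square[symmetric])
  ultimately show ?thesis
    by (metis mult_left_cancel mult_zero_left zero_neq_one)
qed

definition quartic_sum :: "nat \<Rightarrow> nat \<Rightarrow> complex" where
  "quartic_sum q h = (\<Sum>x\<in>{1..<q}. add_char q (h * x ^ 4))"

lemma quartic_sum_cong:
  assumes "q > 0" "[h = h'] (mod q)"
  shows "quartic_sum q h = quartic_sum q h'"
  unfolding quartic_sum_def
  by (intro sum.cong refl add_char_cong assms(1) cong_mult assms(2)) auto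

lemma bij_betw_mult_mod_prime:
  fixes q t :: nat
  assumes "prime q" "\<not> q dvd t"
  shows "bij_betw (\<lambda>x. (t * x) mod q) {1..<q} {1..<q}"
proof -
  have cop: "coprime t q"
    using assms prime_imp_coprime coprime_commute by blast
  have inj: "inj_on (\<lambda>x. (t * x) mod q) {1..<q}"
  proof (rule inj_onI)
    fix x y assume "x \<in> {1..<q}" "y \<in> {1..<q}" "(t * x) mod q = (t * y) mod q"
    then have "[t * x = t * y] (mod q)" by (simp add: cong_def)
    then have "[x = y] (mod q)"
      using cong_mult_lcancel_nat[OF cop] by blast
    then show "x = y"
      using \<open>x \<in> _\<close> \<open>y \<in> _\<close> by (simp add: cong_def)
  qed
  have "(\<lambda>x. (t * x) mod q) ` {1..<q} \<subseteq> {1..<q}"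
  proof clarify
    fix x assume x: "x \<in> {1..<q}"
    then have "\<not> q dvd x" by (auto dest: dvd_imp_le)
    then have "\<not> q dvd t * x" using assms prime_dvd_mult_iff by blast
    then show "(t * x) mod q \<in> {1..<q}"
      using assms prime_gt_0_nat[of q] by (auto simp: dvd_eq_mod_eq_0 Suc_le_eq)
  qed
  with inj show ?thesis
    by (simp add: bij_betw_def endo_inj_surj)
qed

lemma quartic_sum_mult_fourth_power:
  assumes "prime q" "\<not> q dvd t"
  shows "quartic_sum q (h * t ^ 4) = quartic_sum q h"
proof -
  have q: "q > 0" using assms(1) by (simp add: prime_gt_0_nat)
  have "quartic_sum q h = (\<Sum>x\<in>{1..<q}. add_char q (h * ((t * x) mod q) ^ 4))"
    unfolding quartic_sum_def
    using sum.reindex_bij_betw[OF bij_betw_mult_mod_prime[OF assms],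
        of "\<lambda>x. add_char q (h * x ^ 4)"] by simp
  also have "\<dots> = (\<Sum>x\<in>{1..<q}. add_char q (h * t ^ 4 * x ^ 4))"
  proof (intro sum.cong refl add_char_cong q)
    fix x
    have "[((t * x) mod q) ^ 4 = (t * x) ^ 4] (mod q)"
      by (intro cong_pow) simp
    then have "[h * ((t * x) mod q) ^ 4 = h * (t * x) ^ 4] (mod q)"
      by (intro cong_mult) auto
    then show "[h * ((t * x) mod q) ^ 4 = h * t ^ 4 * x ^ 4] (mod q)"
      by (simp add: power_mult_distrib mult_ac)
  qed
  finally show ?thesis by (simp add: quartic_sum_def)
qed

lemma card_fourth_roots_mod_prime_le:
  fixes q a :: nat
  assumes "prime q"
  shows "card {x\<in>{1..<q}. [x ^ 4 = a] (mod q)} \<le> 4"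
proof -
  have "card {x\<in>{1..<q}. [x ^ 4 = a] (mod q)} \<le> card {x\<in>{..<q}. [x ^ 4 = a] (mod q)}"
    by (intro card_mono) auto
  also have "\<dots> \<le> 4" by (intro roots_mod_prime_bound assms) auto
  finally show ?thesis .
qed

text \<open>
  By orthogonality the mean square counts the pairs with \<open>x ^ 4 = y ^ 4\<close> modulo \<open>q\<close>, and each \<open>x\<close> has
  at most four partners.
\<close>
lemma sum_norm_quartic_sum_squared_le:
  assumes "prime q"
  shows "(\<Sum>h<q. (norm (quartic_sum q h))\<^sup>2) \<le> 4 * real q * (real q - 1)"
proof -
  have q: "q > 0" using assms by (simp add: prime_gt_0_nat)
  have "complex_of_real (\<Sum>h<q. (norm (quartic_sum q h))\<^sup>2)
      = (\<Sum>h<q. quartic_sum q h * cnj (quartic_sum q h))"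
    by (simp only: of_real_sum complex_norm_square)
  also have "\<dots> = (\<Sum>h<q. \<Sum>x\<in>{1..<q}. \<Sum>y\<in>{1..<q}. add_char q (h * (x ^ 4 + (q - 1) * y ^ 4)))"
  proof (intro sum.cong refl)
    fix h
    have "add_char q (h * x ^ 4) * cnj (add_char q (h * y ^ 4))
        = add_char q (h * (x ^ 4 + (q - 1) * y ^ 4))" for x y
    proof -
      have "h * (x ^ 4 + (q - 1) * y ^ 4) = h * x ^ 4 + (q - 1) * (h * y ^ 4)"
        by (simp only: distrib_left mult.left_commute[of h "q - 1"])
      then show ?thesis
        by (simp only: cnj_add_char[OF q] add_char_add)
    qed
    then show "quartic_sum q h * cnj (quartic_sum q h)
        = (\<Sum>x\<in>{1..<q}. \<Sum>y\<in>{1..<q}. add_char q (h * (x ^ 4 + (q - 1) * y ^ 4)))"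
      by (simp only: quartic_sum_def cnj_sum sum_product)
  qed
  also have "\<dots> = (\<Sum>x\<in>{1..<q}. \<Sum>h<q. \<Sum>y\<in>{1..<q}. add_char q (h * (x ^ 4 + (q - 1) * y ^ 4)))"
    by (rule sum.swap)
  also have "\<dots> = (\<Sum>x\<in>{1..<q}. \<Sum>y\<in>{1..<q}. \<Sum>h<q. add_char q (h * (x ^ 4 + (q - 1) * y ^ 4)))"
    by (rule sum.cong[OF refl sum.swap])
  also have "\<dots> = (\<Sum>x\<in>{1..<q}. \<Sum>y\<in>{1..<q}. if [y ^ 4 = x ^ 4] (mod q) then of_nat q else 0)"
  proof (intro sum.cong refl)
    fix x y
    have "(q - 1) * y ^ 4 + y ^ 4 = q * y ^ 4"
      using q by (cases q) simp_all
    then have e: "[x ^ 4 + (q - 1) * y ^ 4 + y ^ 4 = x ^ 4] (mod q)"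
      by (simp add: cong_def add.assoc)
    have "q dvd x ^ 4 + (q - 1) * y ^ 4 \<longleftrightarrow> [x ^ 4 + (q - 1) * y ^ 4 + y ^ 4 = 0 + y ^ 4] (mod q)"
      by (simp only: cong_add_rcancel_nat cong_0_iff)
    also have "\<dots> \<longleftrightarrow> [y ^ 4 = x ^ 4] (mod q)"
      using e unfolding cong_def add_0 by (simp only: eq_commute)
    finally show "(\<Sum>h<q. add_char q (h * (x ^ 4 + (q - 1) * y ^ 4)))
        = (if [y ^ 4 = x ^ 4] (mod q) then of_nat q else 0)"
      using sum_add_char[OF q] by simp
  qed
  also have "\<dots> = (\<Sum>x\<in>{1..<q}. of_nat (q * card {y\<in>{1..<q}. [y ^ 4 = x ^ 4] (mod q)}))"
    by (intro sum.cong refl) (simp add: sum.If_cases Int_def mult.commute)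
  also have "\<dots> = complex_of_real (\<Sum>x\<in>{1..<q}. real (q * card {y\<in>{1..<q}. [y ^ 4 = x ^ 4] (mod q)}))"
    by (simp only: of_real_sum of_real_of_nat_eq)
  finally have "(\<Sum>h<q. (norm (quartic_sum q h))\<^sup>2)
      = (\<Sum>x\<in>{1..<q}. real (q * card {y\<in>{1..<q}. [y ^ 4 = x ^ 4] (mod q)}))"
    by (simp only: of_real_eq_iff)
  also have "\<dots> \<le> (\<Sum>x\<in>{1..<q}. real (q * 4))"
    by (intro sum_mono, subst of_nat_le_iff, intro mult_le_mono2 card_fourth_roots_mod_prime_le assms)
  also have "\<dots> = 4 * real q * (real q - 1)"
    using q by (simp add: of_nat_diff)
  finally show ?thesis .
qed

text \<open>
  The sum is constant on the orbit of \<open>h\<close> under multiplication by fourth powers. Such an orbit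
  contains at least \<open>(q - 1) / 4\<close> frequencies, so the square of a single value exceeds the mean
  square by at most a factor of about four. This replaces the evaluation of Gauss sums.
\<close>
lemma norm_quartic_sum_le:
  assumes "prime q" "\<not> q dvd h"
  shows "norm (quartic_sum q h) \<le> 4 * sqrt (real q)"
proof -
  have q: "q > 1" using prime_gt_1_nat assms by blast
  have cop: "coprime h q"
    using assms prime_imp_coprime coprime_commute by blast
  define f where "f k = (norm (quartic_sum q k))\<^sup>2" for k
  have "(real q - 1) * f h = (\<Sum>t\<in>{1..<q}. f h)"
    using q by (simp add: of_nat_diff)
  also have "\<dots> = (\<Sum>t\<in>{1..<q}. f ((h * t ^ 4) mod q))"
  proof (intro sum.cong refl)
    fix t assume "t \<in> {1..<q}"
    then have "\<not> q dvd t" by (auto dest: dvd_imp_le)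
    then have "quartic_sum q (h * t ^ 4) = quartic_sum q h"
      using assms(1) by (intro quartic_sum_mult_fourth_power)
    moreover have "quartic_sum q (h * t ^ 4) = quartic_sum q ((h * t ^ 4) mod q)"
      using q by (intro quartic_sum_cong) auto
    ultimately show "f h = f ((h * t ^ 4) mod q)" by (simp add: f_def)
  qed
  also have "\<dots> = (\<Sum>k<q. \<Sum>t | t \<in> {1..<q} \<and> (h * t ^ 4) mod q = k. f ((h * t ^ 4) mod q))"
    using q by (intro sum.group[symmetric]) auto
  also have "\<dots> = (\<Sum>k<q. real (card {t\<in>{1..<q}. (h * t ^ 4) mod q = k}) * f k)"
    by (intro sum.cong refl) simp
  also have "\<dots> \<le> (\<Sum>k<q. 4 * f k)"
  proof (intro sum_mono mult_right_mono)
    fix k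
    have "card {t\<in>{1..<q}. (h * t ^ 4) mod q = k} \<le> 4"
    proof (cases "{t\<in>{1..<q}. (h * t ^ 4) mod q = k} = {}")
      case False
      then obtain u where u: "u \<in> {1..<q}" "(h * u ^ 4) mod q = k" by auto
      have "{t\<in>{1..<q}. (h * t ^ 4) mod q = k} \<subseteq> {t\<in>{1..<q}. [t ^ 4 = u ^ 4] (mod q)}"
      proof safe
        fix t assume "k = (h * t ^ 4) mod q"
        then have "[h * t ^ 4 = h * u ^ 4] (mod q)" using u by (simp add: cong_def)
        then show "[t ^ 4 = u ^ 4] (mod q)"
          using cong_mult_lcancel_nat[OF cop] by blast
      qed
      then have "card {t\<in>{1..<q}. (h * t ^ 4) mod q = k} \<le> card {t\<in>{1..<q}. [t ^ 4 = u ^ 4] (mod q)}"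
        by (intro card_mono) auto
      also have "\<dots> \<le> 4" by (rule card_fourth_roots_mod_prime_le[OF assms(1)])
      finally show ?thesis .
    next
      case True
      then show ?thesis by (simp only: True) simp
    qed
    then show "real (card {t\<in>{1..<q}. (h * t ^ 4) mod q = k}) \<le> 4" by simp
  qed (auto simp: f_def)
  also have "\<dots> = 4 * (\<Sum>k<q. f k)" by (simp add: sum_distrib_left)
  also have "\<dots> \<le> 4 * (4 * real q * (real q - 1))"
    unfolding f_def using sum_norm_quartic_sum_squared_le[OF assms(1)] by simp
  finally have "(real q - 1) * f h \<le> (real q - 1) * (16 * real q)" by (simp add: mult_ac)
  then have "f h \<le> 16 * real q" using q by simp
  then have "norm (quartic_sum q h) \<le> sqrt (16 * real q)"
    unfolding f_def by (rule real_le_rsqrt)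
  then show ?thesis by (simp add: real_sqrt_mult)
qed

text \<open>
  Only residues prime to \<open>q\<close> are counted: they are the ones that lift uniquely to \<open>q ^ 4\<close>.
\<close>
definition local_count :: "nat \<Rightarrow> nat \<Rightarrow> nat" where
  "local_count q s = card {(x, y, z) \<in> {1..<q} \<times> {1..<q} \<times> {1..<q}. q dvd x ^ 4 + y ^ 4 + z ^ 4 + s}"

text \<open>
  Detect the congruence by additive characters. The zero frequency gives the main term, and three
  factors of square-root size make each other frequency negligible; the bound is uniform in \<open>s\<close>.
\<close>
lemma local_count_approx:
  assumes "prime q"
  shows "\<bar>real q * real (local_count q s) - (real q - 1) ^ 3\<bar> \<le> 64 * real q * (real q * sqrt (real q))"
proof -
  have q: "q > 1" using prime_gt_1_nat assms by blast
  define U where "U = {1..<q}"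
  have finite_UUU: "finite (U \<times> U \<times> U)" by (simp add: U_def)
  have "complex_of_real (real q * real (local_count q s))
      = (\<Sum>v\<in>U \<times> U \<times> U. if q dvd (fst v) ^ 4 + (fst (snd v)) ^ 4 + (snd (snd v)) ^ 4 + s then of_nat q else 0)"
  proof -
    have "local_count q s = card ((U \<times> U \<times> U) \<inter>
        {v. q dvd fst v ^ 4 + fst (snd v) ^ 4 + snd (snd v) ^ 4 + s})"
      unfolding local_count_def U_def[symmetric] by (rule arg_cong[of _ _ card]) auto
    then show ?thesis by (simp only: sum.If_cases[OF finite_UUU]) simp
  qed
  also have "\<dots> = (\<Sum>v\<in>U \<times> U \<times> U. \<Sum>h<q. add_char q (h * ((fst v) ^ 4 + (fst (snd v)) ^ 4 + (snd (snd v)) ^ 4 + s)))"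
    using q by (simp add: sum_add_char)
  also have "\<dots> = (\<Sum>h<q. \<Sum>v\<in>U \<times> U \<times> U. add_char q (h * ((fst v) ^ 4 + (fst (snd v)) ^ 4 + (snd (snd v)) ^ 4 + s)))"
    by (rule sum.swap)
  also have "\<dots> = (\<Sum>h<q. add_char q (h * s) * quartic_sum q h ^ 3)"
  proof (intro sum.cong refl)
    fix h
    have "(\<Sum>v\<in>U \<times> U \<times> U. add_char q (h * ((fst v) ^ 4 + (fst (snd v)) ^ 4 + (snd (snd v)) ^ 4 + s)))
      = (\<Sum>x\<in>U. \<Sum>y\<in>U. \<Sum>z\<in>U. add_char q (h * (x ^ 4 + y ^ 4 + z ^ 4 + s)))"
      by (simp add: sum.cartesian_product case_prod_unfold)
    also have "\<dots> = (\<Sum>x\<in>U. \<Sum>y\<in>U. \<Sum>z\<in>U. add_char q (h * s) * (add_char q (h * x ^ 4) * (add_char q (h * y ^ 4) * add_char q (h * z ^ 4))))"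
      by (simp only: add_char_add distrib_left mult_ac)
    also have "\<dots> = add_char q (h * s) * quartic_sum q h ^ 3"
      unfolding quartic_sum_def U_def[symmetric]
      by (simp only: power3_eq_cube mult.assoc sum_distrib_left[symmetric] sum_distrib_right[symmetric])
    finally show "(\<Sum>v\<in>U \<times> U \<times> U. add_char q (h * ((fst v) ^ 4 + (fst (snd v)) ^ 4 + (snd (snd v)) ^ 4 + s)))
      = add_char q (h * s) * quartic_sum q h ^ 3" .
  qed
  also have "{..<q} = insert 0 {1..<q}" using q by auto
  also have "(\<Sum>h\<in>insert 0 {1..<q}. add_char q (h * s) * quartic_sum q h ^ 3)
      = complex_of_real ((real q - 1) ^ 3) + (\<Sum>h\<in>{1..<q}. add_char q (h * s) * quartic_sum q h ^ 3)"
    using q by (simp add: quartic_sum_def of_nat_diff)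
  finally have "complex_of_real (real q * real (local_count q s) - (real q - 1) ^ 3)
      = (\<Sum>h\<in>{1..<q}. add_char q (h * s) * quartic_sum q h ^ 3)" by simp
  then have "\<bar>real q * real (local_count q s) - (real q - 1) ^ 3\<bar>
      = norm (\<Sum>h\<in>{1..<q}. add_char q (h * s) * quartic_sum q h ^ 3)"
    by (metis norm_of_real)
  also have "\<dots> \<le> (\<Sum>h\<in>{1..<q}. 64 * (real q * sqrt (real q)))"
  proof (rule sum_norm_le)
    fix h assume h: "h \<in> {1..<q}"
    then have "\<not> q dvd h" by (auto dest: dvd_imp_le)
    then have "norm (quartic_sum q h) ^ 3 \<le> (4 * sqrt (real q)) ^ 3"
      by (intro power_mono norm_quartic_sum_le assms) auto
    also have "\<dots> = 64 * (real q * sqrt (real q))"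
      by (simp add: power3_eq_cube power_mult_distrib)
    finally show "norm (add_char q (h * s) * quartic_sum q h ^ 3) \<le> 64 * (real q * sqrt (real q))"
      by (simp add: norm_mult norm_power)
  qed
  also have "\<dots> \<le> 64 * real q * (real q * sqrt (real q))"
    using q by (simp add: of_nat_diff mult_right_mono)
  finally show ?thesis .
qed

section \<open>Lifting solutions to the fourth power of a prime\<close>

lemma card_residue_class:
  fixes m q r :: nat
  assumes "r < q"
  shows "card {x\<in>{..<q * m}. x mod q = r} = m"
proof -
  have "{x\<in>{..<q * m}. x mod q = r} = (\<lambda>i. r + q * i) ` {..<m}"
  proof safe
    fix x assume "x < q * m" "r = x mod q"
    then show "x \<in> (\<lambda>i. x mod q + q * i) ` {..<m}"
      by (intro image_eqI[of _ _ "x div q"]) (auto simp: less_mult_imp_div_less mult.commute)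
  next
    fix i assume "i < m"
    then have "r + q * i < q + q * i" using assms by simp
    also have "\<dots> = q * Suc i" by simp
    also have "\<dots> \<le> q * m" using \<open>i < m\<close> by (intro mult_le_mono2) simp
    finally show "r + q * i < q * m" .
  qed (use assms in auto)
  moreover have "inj_on (\<lambda>i. r + q * i) {..<m}"
    using assms by (auto simp: inj_on_def)
  ultimately show ?thesis by (simp add: card_image)
qed

text \<open>
  In \<open>x ^ 4 - y ^ 4 = (x - y) * (x + y) * (x\<^sup>2 + y\<^sup>2)\<close> the last two factors are congruent to
  \<open>2 * x\<close> and \<open>2 * x\<^sup>2\<close> modulo \<open>q\<close>, so they are units for odd \<open>q\<close>.
\<close>
lemma fourth_power_cong_lift_inj:
  fixes q x y :: nat
  assumes "prime q" "q \<noteq> 2" "\<not> q dvd x" "[x = y] (mod q)" "[x ^ 4 = y ^ 4] (mod q ^ 4)"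
  shows "[x = y] (mod q ^ 4)"
proof -
  define X Y Q where "X = int x" and "Y = int y" and "Q = int q"
  have Q: "prime Q" using assms(1) by (simp add: Q_def)
  have ndvd: "\<not> Q dvd X" using assms(3) by (simp add: X_def Q_def)
  have cong: "[X = Y] (mod Q)" using assms(4) by (simp add: X_def Y_def Q_def cong_int_iff)
  have not2: "\<not> Q dvd 2"
  proof
    assume "Q dvd 2"
    then have "q dvd 2" by (simp add: Q_def int_dvd_int_iff[of q 2, simplified])
    then show False using assms(1,2) by (simp add: primes_dvd_imp_eq)
  qed
  have "[X + Y = X + X] (mod Q)" using cong by (intro cong_add) (auto simp: cong_sym)
  then have 1: "[X + Y = 2 * X] (mod Q)" by simp
  have "[X ^ 2 + Y ^ 2 = X ^ 2 + X ^ 2] (mod Q)"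
    using cong by (intro cong_add cong_pow) (auto simp: cong_sym)
  then have 2: "[X ^ 2 + Y ^ 2 = 2 * X ^ 2] (mod Q)" by simp
  have "\<not> Q dvd X + Y"
    using 1 not2 ndvd Q by (auto simp: cong_dvd_iff prime_dvd_mult_iff)
  moreover have "\<not> Q dvd X ^ 2 + Y ^ 2"
    using 2 not2 ndvd Q by (auto simp: cong_dvd_iff prime_dvd_mult_iff prime_dvd_power_iff)
  ultimately have "\<not> Q dvd (X + Y) * (X ^ 2 + Y ^ 2)"
    using Q by (simp add: prime_dvd_mult_iff)
  then have cop: "coprime (Q ^ 4) ((X + Y) * (X ^ 2 + Y ^ 2))"
    using Q prime_imp_coprime coprime_power_left_iff by blast
  have "[X ^ 4 = Y ^ 4] (mod Q ^ 4)"
    using assms(5) unfolding X_def Y_def Q_def by (metis cong_int_iff of_nat_power)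
  then have "Q ^ 4 dvd X ^ 4 - Y ^ 4" by (simp add: cong_iff_dvd_diff)
  also have "X ^ 4 - Y ^ 4 = (X - Y) * ((X + Y) * (X ^ 2 + Y ^ 2))"
    by (simp add: algebra_simps power4_eq_xxxx power2_eq_square)
  finally have "Q ^ 4 dvd X - Y"
    using cop by (simp add: coprime_dvd_mult_left_iff)
  then have "[X = Y] (mod Q ^ 4)" by (simp add: cong_iff_dvd_diff)
  then show ?thesis unfolding X_def Y_def Q_def by (metis cong_int_iff of_nat_power)
qed

text \<open>
  Raising to the fourth power maps the residues modulo \<open>q ^ 4\<close> above \<open>a\<close> injectively to those above
  \<open>a ^ 4\<close>. Both sets have \<open>q ^ 3\<close> elements, so the map is onto, which avoids successive
  approximation.
\<close>
lemma hensel_fourth_power: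
  fixes q a t :: nat
  assumes "prime q" "q \<noteq> 2" "\<not> q dvd a" "q dvd a ^ 4 + t"
  shows "\<exists>x<q ^ 4. x mod q = a mod q \<and> q ^ 4 dvd x ^ 4 + t"
proof -
  have q: "q > 0" using assms by (simp add: prime_gt_0_nat)
  define S where "S r = {x\<in>{..<q ^ 4}. x mod q = r mod q}" for r
  have q4: "q ^ 4 = q * q ^ 3" using power_Suc[of q 3] by simp
  have card_S: "card (S r) = q ^ 3" for r
    unfolding S_def q4 using q by (intro card_residue_class) simp
  have fin: "finite (S r)" for r by (simp add: S_def)
  have "inj_on (\<lambda>x. x ^ 4 mod q ^ 4) (S a)"
  proof (rule inj_onI)
    fix x y assume xy: "x \<in> S a" "y \<in> S a" "x ^ 4 mod q ^ 4 = y ^ 4 mod q ^ 4"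
    have "\<not> q dvd x"
      using xy(1) assms(3) by (auto simp: S_def dvd_eq_mod_eq_0)
    moreover have "[x = y] (mod q)" using xy(1,2) by (simp add: S_def cong_def)
    moreover have "[x ^ 4 = y ^ 4] (mod q ^ 4)" using xy(3) by (simp only: cong_def)
    ultimately have "[x = y] (mod q ^ 4)"
      by (rule fourth_power_cong_lift_inj[OF assms(1,2)])
    then show "x = y" using xy by (simp add: S_def cong_def)
  qed
  then have "card ((\<lambda>x. x ^ 4 mod q ^ 4) ` S a) = card (S (a ^ 4))"
    by (simp add: card_image card_S)
  moreover have "(\<lambda>x. x ^ 4 mod q ^ 4) ` S a \<subseteq> S (a ^ 4)"
  proof safe
    fix x assume "x \<in> S a"
    then have "[x ^ 4 = a ^ 4] (mod q)" by (intro cong_pow) (simp add: S_def cong_def)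
    moreover have "x ^ 4 mod q ^ 4 mod q = x ^ 4 mod q"
      by (rule mod_mod_cancel) (simp add: q4)
    ultimately show "x ^ 4 mod q ^ 4 \<in> S (a ^ 4)"
      using q by (simp add: S_def cong_def)
  qed
  ultimately have img: "(\<lambda>x. x ^ 4 mod q ^ 4) ` S a = S (a ^ 4)"
    using fin by (metis card_subset_eq)
  \<comment> \<open>A nonnegative representative of \<open>- t\<close>.\<close>
  define c where "c = (q ^ 4 - 1) * t mod q ^ 4"
  have ct: "q ^ 4 dvd c + t"
  proof -
    have "[c + t = (q ^ 4 - 1) * t + t] (mod q ^ 4)"
      by (intro cong_add) (auto simp: c_def)
    also have "(q ^ 4 - 1) * t + t = q ^ 4 * t"
      using q by (metis Suc_diff_1 add.commute mult_Suc zero_less_power)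
    finally show ?thesis by (simp add: cong_def dvd_eq_mod_eq_0)
  qed
  have "q dvd c + t" by (rule dvd_trans[OF _ ct]) (simp add: q4)
  then have "[c + t = a ^ 4 + t] (mod q)"
    using assms(4) by (simp add: cong_def dvd_eq_mod_eq_0)
  then have "[c = a ^ 4] (mod q)" by (simp only: cong_add_rcancel_nat)
  then have "c \<in> S (a ^ 4)" using q by (simp add: S_def c_def cong_def)
  then obtain x where x: "x \<in> S a" "c = x ^ 4 mod q ^ 4" using img by blast
  have "[x ^ 4 + t = c + t] (mod q ^ 4)"
    using x by (intro cong_add) auto
  then have "q ^ 4 dvd x ^ 4 + t" using ct by (simp add: cong_dvd_iff)
  then show ?thesis using x by (auto simp: S_def)
qed

definition cube :: "nat \<Rightarrow> (nat \<times> nat \<times> nat) set" where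
  "cube m = {..<m} \<times> {..<m} \<times> {..<m}"

fun unit_solution :: "nat \<Rightarrow> nat \<Rightarrow> nat \<times> nat \<times> nat \<Rightarrow> bool" where
  "unit_solution s q (x, y, z) \<longleftrightarrow>
     \<not> q dvd x \<and> \<not> q dvd y \<and> \<not> q dvd z \<and> q ^ 4 dvd x ^ 4 + y ^ 4 + z ^ 4 + s"

text \<open>
  A solution modulo \<open>q ^ 4\<close> is determined by its reduction modulo \<open>q\<close> and by arbitrary lifts of the
  last two coordinates, because the first coordinate then lifts in exactly one way.
\<close>
lemma card_unit_solutions:
  assumes "prime q" "q \<noteq> 2"
  shows "card {v \<in> cube (q ^ 4). unit_solution s q v} = q ^ 6 * local_count q s"
proof -
  have q: "q > 0" using assms by (simp add: prime_gt_0_nat)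
  have q4: "q ^ 4 = q * q ^ 3" using power_Suc[of q 3] by simp
  define U where "U = {(x, y, z) \<in> {1..<q} \<times> {1..<q} \<times> {1..<q}. q dvd x ^ 4 + y ^ 4 + z ^ 4 + s}"
  define V where "V = {v \<in> cube (q ^ 4). unit_solution s q v}"
  define f where "f = (\<lambda>(x, y, z). ((x mod q, y mod q, z mod q), (y div q, z div q)))"
  have red: "q dvd (x mod q) ^ 4 + (y mod q) ^ 4 + (z mod q) ^ 4 + s \<longleftrightarrow> q dvd x ^ 4 + y ^ 4 + z ^ 4 + s" for x y z
    by (intro cong_dvd_iff cong_add cong_pow) auto
  have pos: "1 \<le> x mod q \<longleftrightarrow> \<not> q dvd x" for x
    by (simp add: dvd_eq_mod_eq_0 Suc_le_eq)
  have "inj_on f V"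
  proof (rule inj_onI, clarsimp simp: f_def V_def cube_def)
    fix x y z x' y' z'
    assume a: "x mod q = x' mod q" "y mod q = y' mod q" "z mod q = z' mod q" "y div q = y' div q" "z div q = z' div q"
      and b: "x < q ^ 4" "x' < q ^ 4" "\<not> q dvd x"
      and c: "q ^ 4 dvd x ^ 4 + y ^ 4 + z ^ 4 + s" "q ^ 4 dvd x' ^ 4 + y' ^ 4 + z' ^ 4 + s"
    have yz: "y = y'" "z = z'" using a by (metis mult_div_mod_eq)+
    have "[x ^ 4 + (y ^ 4 + z ^ 4 + s) = x' ^ 4 + (y ^ 4 + z ^ 4 + s)] (mod q ^ 4)"
      using c yz by (simp add: cong_def dvd_eq_mod_eq_0 add.assoc)
    then have "[x ^ 4 = x' ^ 4] (mod q ^ 4)" by (simp only: cong_add_rcancel_nat)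
    moreover have "[x = x'] (mod q)" using a(1) by (simp only: cong_def)
    ultimately have "[x = x'] (mod q ^ 4)"
      using b(3) fourth_power_cong_lift_inj[OF assms] by blast
    then show "x = x' \<and> y = y' \<and> z = z'" using b yz by (simp add: cong_def)
  qed
  moreover have "f ` V = U \<times> ({..<q ^ 3} \<times> {..<q ^ 3})"
  proof (intro equalityI subsetI)
    fix w assume "w \<in> f ` V"
    then obtain x y z where w: "w = f (x, y, z)" "x < q ^ 4" "y < q ^ 4" "z < q ^ 4" "unit_solution s q (x, y, z)"
      by (auto simp: V_def cube_def)
    have "q dvd x ^ 4 + y ^ 4 + z ^ 4 + s"
      by (rule dvd_trans[of _ "q ^ 4"]) (use w in auto)
    then show "w \<in> U \<times> ({..<q ^ 3} \<times> {..<q ^ 3})"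
      using w q by (auto simp: f_def U_def pos red q4 mult.commute intro!: less_mult_imp_div_less
          simp del: One_nat_def)
  next
    fix w assume "w \<in> U \<times> ({..<q ^ 3} \<times> {..<q ^ 3})"
    then obtain a b c i j where w: "w = ((a, b, c), (i, j))" "a \<in> {1..<q}" "b \<in> {1..<q}" "c \<in> {1..<q}"
      "q dvd a ^ 4 + b ^ 4 + c ^ 4 + s" "i < q ^ 3" "j < q ^ 3"
      by (auto simp: U_def)
    have nd: "\<not> q dvd a" "\<not> q dvd b" "\<not> q dvd c"
      using w by (auto dest: dvd_imp_le)
    define y z where "y = b + q * i" and "z = c + q * j"
    have lt: "b' + q * i' < q ^ 4" if "b' < q" "i' < q ^ 3" for b' i'
    proof -
      have "b' + q * i' < q * Suc i'" using that by simp
      also have "\<dots> \<le> q * q ^ 3" using that by (intro mult_le_mono2) simp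
      finally show ?thesis by (simp add: q4)
    qed
    have "q dvd a ^ 4 + (y ^ 4 + z ^ 4 + s)"
    proof -
      have "[a ^ 4 + b ^ 4 + c ^ 4 + s = a ^ 4 + y ^ 4 + z ^ 4 + s] (mod q)"
        unfolding y_def z_def by (intro cong_add cong_pow) (auto simp: cong_def)
      then show ?thesis using w(5) by (simp add: cong_dvd_iff add.assoc)
    qed
    from hensel_fourth_power[OF assms nd(1) this] obtain x where
      x: "x < q ^ 4" "x mod q = a mod q" "q ^ 4 dvd x ^ 4 + (y ^ 4 + z ^ 4 + s)" by blast
    have "\<not> q dvd x" using x(2) nd(1) by (simp add: dvd_eq_mod_eq_0)
    moreover have "\<not> q dvd y" "\<not> q dvd z" using nd by (simp_all add: y_def z_def dvd_add_left_iff)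
    ultimately have "(x, y, z) \<in> V"
      using x lt[of b i] lt[of c j] w by (auto simp: V_def cube_def y_def z_def add.assoc)
    moreover have "f (x, y, z) = w"
      using w x by (simp add: f_def y_def z_def)
    ultimately show "w \<in> f ` V" by force
  qed
  ultimately have "card V = card (U \<times> ({..<q ^ 3} \<times> {..<q ^ 3}))"
    by (metis card_image)
  also have "\<dots> = q ^ 6 * local_count q s"
    by (simp add: card_cartesian_product local_count_def U_def flip: power_add)
  finally show ?thesis by (simp add: V_def)
qed

section \<open>Independence of residues modulo coprime numbers\<close>

fun mod3 :: "nat \<times> nat \<times> nat \<Rightarrow> nat \<Rightarrow> nat \<times> nat \<times> nat" where
  "mod3 (x, y, z) m = (x mod m, y mod m, z mod m)"

lemma mod_pair_eq_iff_nat: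
  fixes a b x y :: nat
  assumes "coprime a b" "x < a * b" "y < a * b" "x mod a = y mod a" "x mod b = y mod b"
  shows "x = y"
proof -
  have "[x = y] (mod a * b)"
    using assms by (intro coprime_cong_mult_nat) (auto simp: cong_def)
  then show ?thesis using assms by (simp add: cong_def)
qed

lemma mod_pair_obtain_nat:
  fixes a b u v :: nat
  assumes "coprime a b" "u < a" "v < b"
  obtains x where "x < a * b" "x mod a = u" "x mod b = v"
proof -
  obtain x where "[x = u] (mod a)" "[x = v] (mod b)" "x < a * b"
    using binary_chinese_remainder_unique_nat[OF assms(1), of u v] assms by auto
  then show ?thesis using assms that by (auto simp: cong_def)
qed

text \<open>
  The Chinese remainder theorem for triples: conditions modulo pairwise coprime numbers are
  independent.
\<close>
lemma card_cube_crt: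
  fixes M :: "'i \<Rightarrow> nat" and P :: "'i \<Rightarrow> nat \<times> nat \<times> nat \<Rightarrow> bool"
  assumes "finite B"
    and "\<And>i. i \<in> B \<Longrightarrow> M i > 0"
    and "\<And>i j. i \<in> B \<Longrightarrow> j \<in> B \<Longrightarrow> i \<noteq> j \<Longrightarrow> coprime (M i) (M j)"
    and "\<And>i v. i \<in> B \<Longrightarrow> P i (mod3 v (M i)) = P i v"
  shows "card {v \<in> cube (\<Prod>i\<in>B. M i). \<forall>i\<in>B. P i v} = (\<Prod>i\<in>B. card {v \<in> cube (M i). P i v})"
  using assms
proof (induction B rule: finite_induct)
  case empty
  have "cube (Suc 0) = {(0, 0, 0)}" by (auto simp: cube_def)
  then show ?case by (simp add: cube_def)
next
  case (insert j B)
  define a b where "a = M j" and "b = (\<Prod>i\<in>B. M i)"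
  define Q where "Q v \<longleftrightarrow> (\<forall>i\<in>B. P i v)" for v
  have ab: "coprime a b"
    unfolding a_def b_def using insert by (intro prod_coprime_right insert.prems(2)) auto
  have a0: "a > 0" using insert.prems(1) by (simp add: a_def)
  have b0: "b > 0" using insert.prems(1) insert.hyps by (auto simp: b_def intro!: prod_pos)
  have Pj: "P j (mod3 v a) = P j v" for v
    unfolding a_def using insert.prems(3) by blast
  have Q: "Q (mod3 v b) = Q v" for v
  proof -
    have "P i (mod3 v b) = P i v" if "i \<in> B" for i
    proof -
      have "M i dvd b" unfolding b_def using that insert.hyps by (intro dvd_prodI)
      then have "mod3 (mod3 v b) (M i) = mod3 v (M i)"
        by (cases v) (simp add: mod_mod_cancel)
      then show ?thesis using insert.prems(3) that by (metis insertI2)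
    qed
    then show ?thesis by (simp add: Q_def)
  qed
  define S where "S = {v \<in> cube (a * b). P j v \<and> Q v}"
  define Sa where "Sa = {v \<in> cube a. P j v}"
  define Sb where "Sb = {v \<in> cube b. Q v}"
  define f where "f v = (mod3 v a, mod3 v b)" for v
  have "inj_on f S"
    unfolding inj_on_def S_def cube_def f_def
    using mod_pair_eq_iff_nat[OF ab] by auto
  moreover have "f ` S = Sa \<times> Sb"
  proof (intro equalityI subsetI)
    fix w assume "w \<in> f ` S"
    then obtain v where v: "v \<in> S" "w = f v" by blast
    have "mod3 v a \<in> cube a" "mod3 v b \<in> cube b"
      using a0 b0 by (cases v; simp add: cube_def)+
    then show "w \<in> Sa \<times> Sb"
      using v Pj Q by (simp add: f_def S_def Sa_def Sb_def)
  next
    fix w assume "w \<in> Sa \<times> Sb"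
    then obtain x y z x' y' z' where w: "w = ((x, y, z), (x', y', z'))"
      "x < a" "y < a" "z < a" "x' < b" "y' < b" "z' < b" "P j (x, y, z)" "Q (x', y', z')"
      by (auto simp: Sa_def Sb_def cube_def)
    obtain X where X: "X < a * b" "X mod a = x" "X mod b = x'" using mod_pair_obtain_nat[OF ab w(2,5)] .
    obtain Y where Y: "Y < a * b" "Y mod a = y" "Y mod b = y'" using mod_pair_obtain_nat[OF ab w(3,6)] .
    obtain Z where Z: "Z < a * b" "Z mod a = z" "Z mod b = z'" using mod_pair_obtain_nat[OF ab w(4,7)] .
    have fw: "f (X, Y, Z) = w" using X Y Z w by (simp add: f_def)
    have "P j (X, Y, Z)" using Pj[of "(X, Y, Z)"] w X Y Z by simp
    moreover have "Q (X, Y, Z)" using Q[of "(X, Y, Z)"] w X Y Z by simp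
    ultimately have "(X, Y, Z) \<in> S" using X Y Z by (simp add: S_def cube_def)
    then show "w \<in> f ` S" using fw by force
  qed
  ultimately have "card S = card (Sa \<times> Sb)" by (metis card_image)
  then have "card S = card Sa * card Sb" by (simp add: card_cartesian_product)
  moreover have "card Sb = (\<Prod>i\<in>B. card {v \<in> cube (M i). P i v})"
    unfolding Sb_def b_def Q_def using insert.prems by (intro insert.IH) auto
  moreover have "{v \<in> cube (\<Prod>i\<in>insert j B. M i). \<forall>i\<in>insert j B. P i v} = S"
    using insert.hyps by (simp add: S_def Q_def a_def b_def)
  ultimately show ?case using insert.hyps by (simp add: Sa_def a_def)
qed

lemma sum_crt_product:
  fixes f g :: "nat \<Rightarrow> real" and a b :: nat
  assumes "coprime a b" "a > 0" "b > 0"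
  shows "(\<Sum>x<a * b. f (x mod a) * g (x mod b)) = (\<Sum>u<a. f u) * (\<Sum>v<b. g v)"
proof -
  have "bij_betw (\<lambda>x. (x mod a, x mod b)) {..<a * b} ({..<a} \<times> {..<b})"
    unfolding bij_betw_def
  proof
    show "inj_on (\<lambda>x. (x mod a, x mod b)) {..<a * b}"
      using mod_pair_eq_iff_nat[OF assms(1)] by (auto simp: inj_on_def)
    show "(\<lambda>x. (x mod a, x mod b)) ` {..<a * b} = {..<a} \<times> {..<b}"
    proof (intro equalityI subsetI)
      fix w assume "w \<in> {..<a} \<times> {..<b}"
      then obtain u v where w: "w = (u, v)" "u < a" "v < b" by auto
      obtain x where "x < a * b" "x mod a = u" "x mod b = v"
        using mod_pair_obtain_nat[OF assms(1) w(2,3)] .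
      then show "w \<in> (\<lambda>x. (x mod a, x mod b)) ` {..<a * b}" using w by auto
    qed (use assms in auto)
  qed
  from sum.reindex_bij_betw[OF this, of "\<lambda>w. f (fst w) * g (snd w)"]
  have "(\<Sum>x<a * b. f (x mod a) * g (x mod b)) = (\<Sum>w\<in>{..<a} \<times> {..<b}. f (fst w) * g (snd w))"
    by simp
  also have "\<dots> = (\<Sum>u<a. \<Sum>v<b. f u * g v)"
    by (simp add: sum.cartesian_product case_prod_unfold)
  also have "\<dots> = (\<Sum>u<a. f u) * (\<Sum>v<b. g v)"
    by (simp only: sum_product)
  finally show ?thesis .
qed

lemma sum_periodic:
  fixes g :: "nat \<Rightarrow> real"
  assumes "\<And>n. g (n mod P) = g n"
  shows "(\<Sum>n<N. g n) = real (N div P) * (\<Sum>b<P. g b) + (\<Sum>b<N mod P. g b)"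
proof -
  have shift: "(\<Sum>n\<in>{c * P..<c * P + r}. g n) = (\<Sum>b<r. g b)" for c r
  proof -
    have "(\<Sum>n\<in>{c * P..<c * P + r}. g n) = (\<Sum>n\<in>{0..<r}. g (n + c * P))"
      using sum.shift_bounds_nat_ivl[of g 0 "c * P" r] by (simp add: add.commute)
    also have "\<dots> = (\<Sum>b\<in>{0..<r}. g b)"
    proof (rule sum.cong[OF refl])
      fix x
      have "g (x + c * P) = g ((x + c * P) mod P)" by (simp only: assms)
      also have "(x + c * P) mod P = x mod P" by simp
      finally show "g (x + c * P) = g x" by (simp only: assms)
    qed
    finally show ?thesis by (simp only: atLeast0LessThan)
  qed
  have split: "{..<a + b} = {..<a} \<union> {a..<a + b}" for a b :: nat by auto
  have "{..<N} = {..<N div P * P} \<union> {N div P * P..<N div P * P + N mod P}"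
    using split[of "N div P * P" "N mod P"] by simp
  also have "(\<Sum>n\<in>\<dots>. g n) = (\<Sum>n<N div P * P. g n) + (\<Sum>n\<in>{N div P * P..<N div P * P + N mod P}. g n)"
    by (rule sum.union_disjoint) auto
  also have "(\<Sum>n<N div P * P. g n) = (\<Sum>c<N div P. \<Sum>n\<in>{c * P..<c * P + P}. g n)"
    by (rule sum.nat_group[symmetric])
  also have "\<dots> = real (N div P) * (\<Sum>b<P. g b)"
    by (simp only: shift sum_constant card_lessThan)
  finally show ?thesis by (simp only: shift)
qed

section \<open>The defect of equidistribution\<close>

definition residue_count :: "nat set \<Rightarrow> nat \<Rightarrow> nat \<Rightarrow> nat" where
  "residue_count X M b = card {n \<in> X. n mod M = b}"

text \<open>
  The variance of the residue counts, normalised so that it is the mean square of the relative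
  deviation from equidistribution (a \<open>\<chi>\<^sup>2\<close> statistic divided by the sample size).
\<close>
definition defect :: "nat set \<Rightarrow> nat \<Rightarrow> real" where
  "defect X M = real M * (\<Sum>b<M. (real (residue_count X M b) - real (card X) / real M)\<^sup>2) / (real (card X))\<^sup>2"

lemma defect_nonneg: "defect X M \<ge> 0"
  unfolding defect_def by (intro divide_nonneg_nonneg mult_nonneg_nonneg sum_nonneg) auto

lemma sum_over_residues:
  fixes f :: "nat \<Rightarrow> real"
  assumes "finite X" "M > 0"
  shows "(\<Sum>n\<in>X. f (n mod M)) = (\<Sum>b<M. real (residue_count X M b) * f b)"
proof -
  have "(\<Sum>n\<in>X. f (n mod M)) = (\<Sum>b<M. \<Sum>n | n \<in> X \<and> n mod M = b. f (n mod M))"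
    using assms by (intro sum.group[symmetric]) auto
  also have "\<dots> = (\<Sum>b<M. real (residue_count X M b) * f b)"
    by (intro sum.cong refl) (simp add: residue_count_def)
  finally show ?thesis .
qed

text \<open>
  The relative excess of the residue class of \<open>n\<close>, viewed as a periodic function of \<open>n\<close>. The average
  of \<open>bias X M\<close> over \<open>X\<close> itself is the defect, and for coprime moduli these functions are almost
  orthogonal on a long interval.
\<close>
definition bias :: "nat set \<Rightarrow> nat \<Rightarrow> nat \<Rightarrow> real" where
  "bias X M n = real M * real (residue_count X M (n mod M)) / real (card X) - 1"

lemma bias_mod [simp]: "bias X M (n mod M) = bias X M n"
  by (simp add: bias_def)

context
  fixes X :: "nat set" and M :: nat
  assumes X: "finite X" "X \<noteq> {}" and M: "M > 0"
begin

lemma sum_residue_count: "(\<Sum>b<M. real (residue_count X M b)) = real (card X)"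
  using sum_over_residues[OF X(1) M, of "\<lambda>_. 1"] by simp

lemma bias_eq:
  assumes "b < M"
  shows "bias X M b = real M / real (card X) * (real (residue_count X M b) - real (card X) / real M)"
  using X M assms by (simp add: bias_def field_simps)

lemma sum_bias: "(\<Sum>b<M. bias X M b) = 0"
proof -
  have "(\<Sum>b<M. bias X M b)
      = real M / real (card X) * (\<Sum>b<M. real (residue_count X M b) - real (card X) / real M)"
    unfolding sum_distrib_left by (intro sum.cong refl bias_eq) auto
  also have "\<dots> = 0" using M by (simp add: sum_subtractf sum_residue_count)
  finally show ?thesis .
qed

lemma sum_bias_squared: "(\<Sum>b<M. (bias X M b)\<^sup>2) = real M * defect X M"
proof -
  have "(\<Sum>b<M. (bias X M b)\<^sup>2)
      = (\<Sum>b<M. (real M / real (card X))\<^sup>2 * (real (residue_count X M b) - real (card X) / real M)\<^sup>2)"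
    by (intro sum.cong refl) (simp only: lessThan_iff bias_eq power_mult_distrib)
  also have "\<dots> = (real M / real (card X))\<^sup>2 * (\<Sum>b<M. (real (residue_count X M b) - real (card X) / real M)\<^sup>2)"
    by (simp only: sum_distrib_left)
  also have "\<dots> = real M * defect X M"
    by (simp add: defect_def power_divide power2_eq_square)
  finally show ?thesis .
qed

lemma sum_bias_over_set: "(\<Sum>n\<in>X. bias X M n) = real (card X) * defect X M"
proof -
  have c: "real (card X) > 0" using X by (simp add: card_gt_0_iff)
  have "(\<Sum>n\<in>X. bias X M n) = (\<Sum>b<M. real (residue_count X M b) * bias X M b)"
    using sum_over_residues[OF X(1) M, of "bias X M"] by simp
  also have "\<dots> = (\<Sum>b<M. (real (card X) / real M) * (bias X M b)\<^sup>2 + real (card X) / real M * bias X M b)"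
  proof (intro sum.cong refl)
    fix b assume "b \<in> {..<M}"
    then have "real (residue_count X M b) = real (card X) / real M * (bias X M b + 1)"
      using c M by (simp add: bias_def)
    then show "real (residue_count X M b) * bias X M b
        = (real (card X) / real M) * (bias X M b)\<^sup>2 + real (card X) / real M * bias X M b"
      by (simp only: power2_eq_square distrib_left distrib_right mult_ac mult_1_left)
  qed
  also have "\<dots> = real (card X) / real M * (\<Sum>b<M. (bias X M b)\<^sup>2) + real (card X) / real M * (\<Sum>b<M. bias X M b)"
    by (simp only: sum.distrib sum_distrib_left)
  also have "\<dots> = real (card X) * defect X M"
    using M by (simp add: sum_bias sum_bias_squared)
  finally show ?thesis .
qed

lemma abs_bias_le: "\<bar>bias X M n\<bar> \<le> real M"
proof -
  have c: "real (card X) > 0" using X by (simp add: card_gt_0_iff)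
  have "residue_count X M (n mod M) \<le> card X"
    unfolding residue_count_def using X by (intro card_mono) auto
  then have "real M * real (residue_count X M (n mod M)) \<le> real M * real (card X)"
    by (intro mult_left_mono) auto
  then have "real M * real (residue_count X M (n mod M)) / real (card X) \<le> real M"
    using c by (simp add: field_simps)
  moreover have "real M * real (residue_count X M (n mod M)) / real (card X) \<ge> 0" by simp
  moreover have "real M \<ge> 1" using M by simp
  ultimately show ?thesis unfolding bias_def by linarith
qed

lemma sum_bias_squared_initial_le:
  "(\<Sum>n<N. (bias X M n)\<^sup>2) \<le> real (N + M) * defect X M"
proof -
  have "(\<Sum>n<N. (bias X M n)\<^sup>2)
      = real (N div M) * (\<Sum>b<M. (bias X M b)\<^sup>2) + (\<Sum>b<N mod M. (bias X M b)\<^sup>2)"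
    by (rule sum_periodic) simp
  also have "(\<Sum>b<N mod M. (bias X M b)\<^sup>2) \<le> (\<Sum>b<M. (bias X M b)\<^sup>2)"
    using M by (intro sum_mono2) (auto intro: less_trans)
  also have "real (N div M) * (\<Sum>b<M. (bias X M b)\<^sup>2) + (\<Sum>b<M. (bias X M b)\<^sup>2)
      = real (N div M * M + M) * defect X M"
    by (simp add: sum_bias_squared algebra_simps)
  also have "\<dots> \<le> real (N + M) * defect X M"
    by (intro mult_right_mono defect_nonneg) (simp del: of_nat_add of_nat_mult)
  finally show ?thesis by simp
qed

end

text \<open>
  Over a full period of length \<open>a * b\<close> the sum factors into two vanishing sums; only an incomplete
  period contributes.
\<close>
lemma sum_bias_product_le:
  assumes "finite X" "X \<noteq> {}" "a > 0" "b > 0" "coprime a b" "a \<le> T" "b \<le> T"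
  shows "(\<Sum>n<N. bias X a n * bias X b n) \<le> real T ^ 4"
proof -
  have ab: "a * b > 0" using assms by simp
  have "(\<Sum>n<N. bias X a n * bias X b n)
      = real (N div (a * b)) * (\<Sum>n<a * b. bias X a n * bias X b n) + (\<Sum>n<N mod (a * b). bias X a n * bias X b n)"
  proof (rule sum_periodic)
    fix n
    have "bias X a (n mod (a * b)) = bias X a n" "bias X b (n mod (a * b)) = bias X b n"
      by (simp_all add: bias_def mod_mod_cancel)
    then show "bias X a (n mod (a * b)) * bias X b (n mod (a * b)) = bias X a n * bias X b n" by simp
  qed
  also have "(\<Sum>n<a * b. bias X a n * bias X b n) = (\<Sum>u<a. bias X a u) * (\<Sum>v<b. bias X b v)"
    using sum_crt_product[OF assms(5,3,4), of "bias X a" "bias X b"] by simp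
  also have "\<dots> = 0" using assms by (simp add: sum_bias)
  also have "real (N div (a * b)) * 0 + (\<Sum>n<N mod (a * b). bias X a n * bias X b n)
      \<le> (\<Sum>n<N mod (a * b). real T * real T)"
  proof -
    have "bias X a n * bias X b n \<le> real T * real T" for n
    proof -
      have "bias X a n * bias X b n \<le> \<bar>bias X a n\<bar> * \<bar>bias X b n\<bar>"
        by (simp add: abs_mult[symmetric])
      also have "\<dots> \<le> real T * real T"
        using abs_bias_le[OF assms(1,2,3), of n] abs_bias_le[OF assms(1,2,4), of n] assms(6,7)
        by (intro mult_mono) auto
      finally show ?thesis .
    qed
    then show ?thesis by (simp only: mult_zero_right add_0 sum_mono)
  qed
  also have "\<dots> = real (N mod (a * b)) * (real T * real T)" by simp
  also have "\<dots> \<le> (real T * real T) * (real T * real T)"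
  proof (intro mult_right_mono)
    have "N mod (a * b) \<le> T * T"
      using ab assms(6,7) by (intro order.trans[OF less_imp_le[OF mod_less_divisor] mult_le_mono]) auto
    then show "real (N mod (a * b)) \<le> real T * real T"
      by (metis of_nat_le_iff of_nat_mult)
  qed auto
  also have "\<dots> = real T ^ 4" by (simp add: power4_eq_xxxx)
  finally show ?thesis .
qed

text \<open>
  Bessel's inequality for the almost orthogonal functions \<open>bias X (M i)\<close>: up to the factor
  \<open>card X\<close>, the sum of the defects is the correlation of the indicator function of \<open>X\<close> with their sum, and is estimated by
  Cauchy--Schwarz. The size condition makes the error from incomplete periods at most \<open>N\<close>.
\<close>
lemma sum_defect_le:
  fixes M :: "'i \<Rightarrow> nat"
  assumes X: "X \<subseteq> {1..N}" "X \<noteq> {}" and I: "finite I" and T: "T \<ge> 2"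
    and M: "\<And>i. i \<in> I \<Longrightarrow> 0 < M i \<and> M i \<le> T"
    and cop: "\<And>i j. i \<in> I \<Longrightarrow> j \<in> I \<Longrightarrow> i \<noteq> j \<Longrightarrow> coprime (M i) (M j)"
    and size: "(card I)\<^sup>2 * T ^ 4 \<le> N"
  shows "(\<Sum>i\<in>I. defect X (M i)) \<le> 3 * real N / real (card X)"
proof (cases "I = {}")
  case False
  have fX: "finite X" using X finite_subset by blast
  define c where "c = real (card X)"
  have c0: "c > 0" using fX X by (simp add: c_def card_gt_0_iff)
  have cN: "c \<le> real N" unfolding c_def using card_mono[OF _ X(1)] by simp
  define S where "S = (\<Sum>i\<in>I. defect X (M i))"
  have S0: "S \<ge> 0" unfolding S_def by (intro sum_nonneg defect_nonneg)
  define k where "k = card I"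
  have k: "k \<ge> 1" unfolding k_def using False I by (simp add: Suc_le_eq card_gt_0_iff)
  have "T + 1 \<le> N"
  proof -
    have "T + 1 \<le> T * 2" using T by simp
    also have "\<dots> \<le> T * T ^ 3" using T power_increasing[of 1 3 T] by (intro mult_le_mono2) simp
    also have "\<dots> = T ^ 4" using power_Suc[of T 3] by simp
    also have "\<dots> \<le> k\<^sup>2 * T ^ 4" using k by simp
    also have "\<dots> \<le> N" using size by (simp add: k_def)
    finally show ?thesis .
  qed
  have "(\<Sum>n\<in>X. \<Sum>i\<in>I. bias X (M i) n) = (\<Sum>i\<in>I. \<Sum>n\<in>X. bias X (M i) n)"
    by (rule sum.swap)
  also have "\<dots> = (\<Sum>i\<in>I. c * defect X (M i))"
    unfolding c_def by (intro sum.cong refl sum_bias_over_set fX X(2)) (use M in auto)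
  also have "\<dots> = c * S" by (simp add: S_def sum_distrib_left)
  finally have 1: "(\<Sum>n\<in>X. \<Sum>i\<in>I. bias X (M i) n) = c * S" .
  have "(\<Sum>n\<in>X. \<Sum>i\<in>I. bias X (M i) n)\<^sup>2 \<le> (\<Sum>n\<in>X. (\<Sum>i\<in>I. bias X (M i) n)\<^sup>2) * c"
    unfolding c_def by (rule sum_squared_le_sum_of_squares)
  then have "(c * S)\<^sup>2 \<le> (\<Sum>n\<in>X. (\<Sum>i\<in>I. bias X (M i) n)\<^sup>2) * c"
    by (simp only: 1)
  also have sub: "(\<Sum>n\<in>X. (\<Sum>i\<in>I. bias X (M i) n)\<^sup>2) \<le> (\<Sum>n<N + 1. (\<Sum>i\<in>I. bias X (M i) n)\<^sup>2)"
    using X by (intro sum_mono2) auto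
  also have "(\<Sum>n<N + 1. (\<Sum>i\<in>I. bias X (M i) n)\<^sup>2)
      = (\<Sum>n<N + 1. \<Sum>i\<in>I. \<Sum>j\<in>I. bias X (M i) n * bias X (M j) n)"
    by (simp only: power2_eq_square sum_product)
  also have "\<dots> = (\<Sum>i\<in>I. \<Sum>n<N + 1. \<Sum>j\<in>I. bias X (M i) n * bias X (M j) n)"
    by (rule sum.swap)
  also have "\<dots> = (\<Sum>i\<in>I. \<Sum>j\<in>I. \<Sum>n<N + 1. bias X (M i) n * bias X (M j) n)"
    by (rule sum.cong[OF refl sum.swap])
  also have "\<dots> \<le> (\<Sum>i\<in>I. \<Sum>j\<in>I. (if j = i then 2 * real N * defect X (M i) else 0) + real T ^ 4)"
  proof (intro sum_mono)
    fix i j assume ij: "i \<in> I" "j \<in> I"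
    show "(\<Sum>n<N + 1. bias X (M i) n * bias X (M j) n)
        \<le> (if j = i then 2 * real N * defect X (M i) else 0) + real T ^ 4"
    proof (cases "j = i")
      case True
      have "(\<Sum>n<N + 1. bias X (M i) n * bias X (M j) n) = (\<Sum>n<N + 1. (bias X (M i) n)\<^sup>2)"
        by (simp only: True power2_eq_square)
      also have "\<dots> \<le> real (N + 1 + M i) * defect X (M i)"
        by (rule sum_bias_squared_initial_le) (use fX X M ij in auto)
      also have "\<dots> \<le> (2 * real N) * defect X (M i)"
        using \<open>T + 1 \<le> N\<close> M[OF ij(1)] by (intro mult_right_mono defect_nonneg) simp
      also have "\<dots> \<le> 2 * real N * defect X (M i) + real T ^ 4" by simp
      finally show ?thesis by (simp only: True if_True refl)
    next
      case False
      have "(\<Sum>n<N + 1. bias X (M i) n * bias X (M j) n) \<le> real T ^ 4"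
        by (rule sum_bias_product_le) (use fX X M ij cop False in auto)
      then show ?thesis using False by simp
    qed
  qed
  also have "\<dots> = (\<Sum>i\<in>I. 2 * real N * defect X (M i) + real k * real T ^ 4)"
    using I by (simp add: sum.distrib k_def)
  also have "\<dots> = 2 * real N * S + real (k\<^sup>2 * T ^ 4)"
    by (simp add: sum.distrib S_def k_def sum_distrib_left power2_eq_square)
  also have "\<dots> \<le> 2 * real N * S + real N"
    using size by (simp only: k_def of_nat_le_iff add_left_mono)
  finally have "(c * S)\<^sup>2 \<le> (2 * real N * S + real N) * c"
    using c0 by (simp add: mult_right_mono)
  then have "c * (c * S\<^sup>2) \<le> c * (2 * real N * S + real N)"
    by (simp add: power2_eq_square mult_ac)
  then have main: "c * S\<^sup>2 \<le> 2 * real N * S + real N" using c0 by simp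
  \<comment> \<open>For \<open>S \<le> 1\<close> the claim is trivial; otherwise the error term \<open>real N\<close> is absorbed into \<open>real N * S\<close>.\<close>
  have "S \<le> 3 * real N / c"
  proof (cases "S \<le> 1")
    case True
    also have "1 \<le> 3 * real N / c" using c0 cN by (simp add: field_simps)
    finally show ?thesis .
  next
    case False
    then have "real N * 1 \<le> real N * S" by (intro mult_left_mono) auto
    then have "(c * S) * S \<le> (3 * real N) * S" using main by (simp add: power2_eq_square algebra_simps)
    then have "c * S \<le> 3 * real N" using False by simp
    then show ?thesis using c0 by (simp add: field_simps)
  qed
  then show ?thesis by (simp add: S_def c_def)
qed simp

section \<open>Reciprocals of primes\<close>

lemma prod_prime_factors_squarefree:
  fixes n :: nat
  assumes "squarefree n"
  shows "\<Prod>(prime_factors n) = n"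
proof -
  have n: "n \<noteq> 0" using assms by (metis not_squarefree_0)
  then have "multiplicity p n = 1" if "p \<in> prime_factors n" for p
    using assms that squarefree_factorial_semiring'[OF n] by blast
  then have "\<Prod>(prime_factors n) = (\<Prod>p\<in>prime_factors n. p ^ multiplicity p n)"
    by (intro prod.cong) auto
  also have "\<dots> = n" using n by (intro prime_factorization_nat[symmetric]) simp
  finally show ?thesis .
qed

lemma sum_inverse_squares_le: "(\<Sum>k\<in>{1..n}. 1 / (real k)\<^sup>2) \<le> 2"
proof -
  have "(\<Sum>k\<in>{1..Suc m}. 1 / (real k)\<^sup>2) \<le> 2 - 1 / real (Suc m)" for m
  proof (induction m)
    case (Suc m)
    have "1 / (real (Suc (Suc m)))\<^sup>2 \<le> 1 / (real (Suc m) * real (Suc (Suc m)))"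
      unfolding power2_eq_square by (intro divide_left_mono mult_right_mono) auto
    also have "\<dots> = 1 / real (Suc m) - 1 / real (Suc (Suc m))"
      by (simp add: field_simps)
    finally show ?case using Suc.IH by simp
  qed simp
  note * = this
  show ?thesis
  proof (cases n)
    case (Suc m)
    have "1 / real (Suc m) \<ge> 0" by simp
    then show ?thesis unfolding Suc using *[of m] by linarith
  qed simp
qed

text \<open>
  Each number up to \<open>n\<close> is a product of distinct primes up to \<open>n\<close> times a square, and
  the sum of the inverse squares is at most 2.
\<close>
lemma harm_le_prod_primes:
  "(harm n :: real) \<le> 2 * (\<Prod>p | prime p \<and> p \<le> n. 1 + 1 / real p)"
proof -
  define P where "P = {p. prime p \<and> p \<le> n}"
  have fP: "finite P" unfolding P_def by simp
  define f where "f m = (prime_factors (squarefree_part m), square_part m)" for m :: nat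
  define w where "w = (\<lambda>(S :: nat set, k :: nat). (\<Prod>p\<in>S. 1 / real p) * (1 / (real k)\<^sup>2))"
  have dec: "m = \<Prod>(fst (f m)) * (snd (f m))\<^sup>2" for m
    using squarefree_decompose[of m] by (simp add: f_def prod_prime_factors_squarefree)
  have wf: "w (f m) = 1 / real m" for m
  proof -
    have "real m = real (\<Prod>(fst (f m))) * (real (snd (f m)))\<^sup>2"
      by (metis dec of_nat_mult of_nat_power)
    then show ?thesis by (simp add: w_def case_prod_unfold prod_dividef)
  qed
  have w0: "w v \<ge> 0" for v by (cases v) (simp add: w_def prod_nonneg)
  have inj: "inj_on f {1..n}"
    by (rule inj_onI) (metis dec)
  have img: "f ` {1..n} \<subseteq> Pow P \<times> {1..n}"
  proof
    fix v assume "v \<in> f ` {1..n}"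
    then obtain m where m: "m \<in> {1..n}" "v = f m" by blast
    have 1: "squarefree_part m dvd m"
      using dvd_triv_left[of "squarefree_part m" "(square_part m)\<^sup>2"] squarefree_decompose[of m] by simp
    have 2: "square_part m dvd m"
      by (rule dvd_trans[OF _ square_part_square_dvd]) simp
    from 1 2 have "squarefree_part m \<le> n" "square_part m \<le> n" "square_part m > 0"
      using m by (auto dest!: dvd_imp_le intro!: Nat.gr0I)
    moreover have "p \<le> squarefree_part m" if "p \<in> prime_factors (squarefree_part m)" for p
      using that by (intro dvd_imp_le) (auto intro!: Nat.gr0I)
    ultimately have "prime_factors (squarefree_part m) \<subseteq> P"
      unfolding P_def using order.trans by blast
    then show "v \<in> Pow P \<times> {1..n}"
      using m(2) \<open>square_part m \<le> n\<close> \<open>square_part m > 0\<close> by (simp add: f_def Suc_le_eq)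
  qed
  have "(harm n :: real) = (\<Sum>m\<in>{1..n}. w (f m))"
    by (simp add: harm_def wf inverse_eq_divide)
  also have "\<dots> = (\<Sum>v\<in>f ` {1..n}. w v)"
    using inj by (simp add: sum.reindex)
  also have "\<dots> \<le> (\<Sum>v\<in>Pow P \<times> {1..n}. w v)"
    using img fP w0 by (intro sum_mono2) auto
  also have "\<dots> = (\<Sum>S\<in>Pow P. \<Sum>k\<in>{1..n}. (\<Prod>p\<in>S. 1 / real p) * (1 / (real k)\<^sup>2))"
    by (simp add: sum.cartesian_product w_def)
  also have "\<dots> = (\<Sum>S\<in>Pow P. \<Prod>p\<in>S. 1 / real p) * (\<Sum>k\<in>{1..n}. 1 / (real k)\<^sup>2)"
    by (simp only: sum_product)
  also have "(\<Sum>S\<in>Pow P. \<Prod>p\<in>S. 1 / real p) = (\<Prod>p\<in>P. 1 / real p + 1)"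
    using prod_add[OF fP, of "\<lambda>p. 1 / real p" "\<lambda>_. 1"] by simp
  also have "(\<Prod>p\<in>P. 1 / real p + 1) * (\<Sum>k\<in>{1..n}. 1 / (real k)\<^sup>2) \<le> (\<Prod>p\<in>P. 1 / real p + 1) * 2"
    by (intro mult_left_mono sum_inverse_squares_le prod_nonneg) auto
  finally show ?thesis by (simp add: P_def add.commute mult.commute)
qed

lemma sum_prime_reciprocals_ge:
  assumes "n \<ge> 2"
  shows "ln (ln (real n)) - ln 2 \<le> (\<Sum>p | prime p \<and> p \<le> n. 1 / real p)"
proof -
  define s where "s = (\<Sum>p | prime p \<and> p \<le> n. 1 / real p)"
  have "ln (real n) \<le> ln (real n + 1)" using assms by simp
  also have "\<dots> \<le> harm n" by (rule ln_le_harm)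
  also have "\<dots> \<le> 2 * (\<Prod>p | prime p \<and> p \<le> n. 1 + 1 / real p)" by (rule harm_le_prod_primes)
  also have "\<dots> \<le> 2 * (\<Prod>p | prime p \<and> p \<le> n. exp (1 / real p))"
    by (intro mult_left_mono prod_mono conjI exp_ge_add_one_self) auto
  also have "\<dots> = 2 * exp s" by (simp add: s_def exp_sum)
  finally have "ln (ln (real n)) \<le> ln (2 * exp s)"
    using assms by (subst ln_le_cancel_iff) auto
  also have "\<dots> = ln 2 + s" by (simp add: ln_mult)
  finally show ?thesis by (simp add: s_def)
qed

section \<open>A block of primes with small defect\<close>

text \<open>
  If in every block of \<open>L\<close> consecutive primes some \<open>p\<close> violated the bound, then the defect of a block
  would exceed \<open>1 / 384\<close> times the reciprocal of each prime of the next block. Summation over the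
  blocks bounds the sum of the reciprocals of the primes up to \<open>y\<close>, apart from the first
  \<open>n0 + L\<close> primes, by a multiple of the total defect, which contradicts the growth of that sum.
\<close>
lemma exists_equidistributed_block:
  fixes X :: "nat set"
  assumes X: "X \<subseteq> {1..N}" "X \<noteq> {}" and L: "L \<ge> 1" and y: "y \<ge> 2"
    and N: "y ^ (16 * L + 2) \<le> N"
    and large: "ln (ln (real y)) > real n0 + real L + 1 + 1152 * real L * real N / real (card X)"
  obtains B where "finite B" "card B = L" "\<And>p. p \<in> B \<Longrightarrow> prime p" "\<And>p. p \<in> B \<Longrightarrow> n0 \<le> p"
    "\<And>p. p \<in> B \<Longrightarrow> defect X ((\<Prod>B) ^ 4) \<le> 1 / (384 * real p)"
proof (rule ccontr)
  assume neg: "\<not> thesis"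
  define P where "P = {p :: nat. prime p}"
  have inf: "infinite P" unfolding P_def by (rule primes_infinite)
  define p where "p = enumerate P"
  have p_prime: "prime (p n)" for n
    using enumerate_in_set[OF inf] by (auto simp: p_def P_def)
  have p_less: "p m < p n \<longleftrightarrow> m < n" for m n
    unfolding p_def by (rule enumerate_mono_iff[OF inf])
  have p_le: "p m \<le> p n \<longleftrightarrow> m \<le> n" for m n
    unfolding p_def by (rule enumerate_mono_le_iff[OF inf])
  have p_gt: "n < p n" for n
  proof (induction n)
    case 0 show ?case using p_prime[of 0] by (simp add: prime_gt_0_nat)
  next
    case (Suc n) then show ?case using p_less[of n "Suc n"] by simp
  qed
  \<comment> \<open>The number of primes up to \<open>y\<close>, as the primes are enumerated from index 0.\<close>
  define \<pi> where "\<pi> = (LEAST n. y < p n)"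
  have ex: "y < p y" by (rule p_gt)
  have \<pi>: "y < p \<pi>" unfolding \<pi>_def by (rule LeastI[of _ y]) (rule ex)
  have below: "p n \<le> y" if "n < \<pi>" for n
    using not_less_Least[of n "\<lambda>n. y < p n"] that by (simp add: \<pi>_def)
  have \<pi>_le: "\<pi> \<le> y" unfolding \<pi>_def by (rule Least_le) (rule ex)
  have primes_eq: "{q. prime q \<and> q \<le> y} = p ` {..<\<pi>}"
  proof (intro equalityI subsetI)
    fix q assume q: "q \<in> {q. prime q \<and> q \<le> y}"
    then obtain n where n: "p n = q"
      using enumerate_Ex[OF inf, of q] by (auto simp: p_def P_def)
    then have "p n < p \<pi>" using q \<pi> by simp
    then show "q \<in> p ` {..<\<pi>}" using n by (auto simp: p_less)
  qed (use p_prime below in auto)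
  have p_inj: "inj_on p S" for S
    by (rule inj_onI) (metis p_le le_antisym order_refl)
  have p0: "real (p n) > 0" for n using p_prime by (simp add: prime_gt_0_nat)
  \<comment> \<open>The blocks consist of primes with index at least \<open>n0\<close>; those primes exceed \<open>n0\<close>.\<close>
  define K where "K = (\<pi> - n0) div L"
  define B where "B k = p ` {n0 + k * L..<n0 + k * L + L}" for k
  define M where "M k = (\<Prod>(B k)) ^ 4" for k
  define T where "T = y ^ (4 * L)"
  have idx: "n0 + k * L + L \<le> \<pi>" if "k < K" for k
  proof -
    have "Suc k * L \<le> K * L" using that by (intro mult_le_mono1) simp
    also have "\<dots> \<le> \<pi> - n0" unfolding K_def by (rule div_times_less_eq_dividend)
    finally have "k * L + L \<le> \<pi> - n0" by simp
    then show ?thesis using L by linarith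
  qed
  have B_props: "finite (B k)" "card (B k) = L" "q \<in> B k \<Longrightarrow> prime q" "q \<in> B k \<Longrightarrow> n0 \<le> q" for k q
  proof -
    show "finite (B k)" by (simp add: B_def)
    show "card (B k) = L" by (simp add: B_def card_image p_inj)
    show "q \<in> B k \<Longrightarrow> prime q" using p_prime by (auto simp: B_def)
    show "n0 \<le> q" if q: "q \<in> B k"
    proof -
      obtain n where "n0 + k * L \<le> n" "q = p n" using q by (auto simp: B_def)
      then show ?thesis using p_gt[of n] by linarith
    qed
  qed
  have large_defect: "1 / (384 * real (p (n0 + k * L + L))) \<le> defect X (M k)" for k
  proof -
    have "\<exists>q\<in>B k. defect X (M k) > 1 / (384 * real q)"
    proof (rule ccontr)
      assume "\<not> ?thesis"
      then have "defect X ((\<Prod>(B k)) ^ 4) \<le> 1 / (384 * real q)" if "q \<in> B k" for q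
        using that by (auto simp: M_def not_less)
      then show False using neg that B_props by metis
    qed
    then obtain q where q: "q \<in> B k" "defect X (M k) > 1 / (384 * real q)" by blast
    then obtain n where "n < n0 + k * L + L" "q = p n" by (auto simp: B_def)
    then have "q \<le> p (n0 + k * L + L)" using p_le by simp
    then have "1 / (384 * real (p (n0 + k * L + L))) \<le> 1 / (384 * real q)"
      using p0 prime_gt_0_nat[OF B_props(3)[OF q(1)]] by (intro divide_left_mono) auto
    then show ?thesis using q(2) by linarith
  qed
  have sum_defect: "(\<Sum>k<K. defect X (M k)) \<le> 3 * real N / real (card X)"
  proof (rule sum_defect_le[OF X])
    show "T \<ge> 2"
    proof -
      have "y ^ 1 \<le> y ^ (4 * L)" using y L by (intro power_increasing) auto
      then show ?thesis using y by (simp add: T_def)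
    qed
    show "0 < M k \<and> M k \<le> T" if "k \<in> {..<K}" for k
    proof
      show "0 < M k" unfolding M_def using B_props(3) by (intro zero_less_power prod_pos) (auto simp: prime_gt_0_nat)
      have "\<Prod>(B k) \<le> (\<Prod>q\<in>B k. y)"
      proof (rule prod_mono)
        fix q assume "q \<in> B k"
        then obtain n where "n < n0 + k * L + L" "q = p n" by (auto simp: B_def)
        then show "0 \<le> q \<and> q \<le> y" using below[of n] idx[of k] that by simp
      qed
      also have "\<dots> = y ^ L" by (simp add: B_props)
      finally have "M k \<le> (y ^ L) ^ 4" unfolding M_def by (intro power_mono) auto
      then show "M k \<le> T" by (simp add: T_def mult.commute flip: power_mult)
    qed
    show "coprime (M i) (M j)" if "i \<noteq> j" for i j
    proof -
      have disj: "B i \<inter> B j = {}"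
      proof -
        have "{n0 + i * L..<n0 + i * L + L} \<inter> {n0 + j * L..<n0 + j * L + L} = {}"
        proof -
          have step: "i * L + L \<le> j * L" if "i < j" for i j
            using mult_le_mono1[of "Suc i" j L] that by simp
          from \<open>i \<noteq> j\<close> consider "i < j" | "j < i" by linarith
          then show ?thesis
            using step[of i j] step[of j i] by cases auto
        qed
        then show ?thesis unfolding B_def using p_inj[of UNIV] by (simp flip: image_Int)
      qed
      have "coprime a b" if "a \<in> B i" "b \<in> B j" for a b
        using that disj B_props(3) by (intro primes_coprime) auto
      then show ?thesis unfolding M_def by (simp add: prod_coprime_left prod_coprime_right)
    qed
    show "(card {..<K})\<^sup>2 * T ^ 4 \<le> N"
    proof -
      have T4: "T ^ 4 = y ^ (16 * L)" unfolding T_def by (simp flip: power_mult)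
      have "K \<le> \<pi>" unfolding K_def by (metis div_le_dividend diff_le_self order.trans)
      then have "K\<^sup>2 * T ^ 4 \<le> y\<^sup>2 * T ^ 4" using \<pi>_le by (intro mult_le_mono1 power_mono) auto
      also have "\<dots> = y ^ (16 * L + 2)"
        by (simp only: T4 power_add mult.commute)
      finally show ?thesis using N by simp
    qed
  qed simp
  \<comment> \<open>Each prime of block \<open>k + 1\<close> is at least the prime with index \<open>n0 + k * L + L\<close>, which bounds block \<open>k\<close> from above.\<close>
  have tail: "(\<Sum>n\<in>{n0 + L..<n0 + L + K * L}. 1 / real (p n)) \<le> 1152 * real L * real N / real (card X)"
  proof -
    have "(\<Sum>n\<in>{n0 + L..<n0 + L + K * L}. 1 / real (p n)) = (\<Sum>n<K * L. 1 / real (p (n + (n0 + L))))"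
      using sum.shift_bounds_nat_ivl[of "\<lambda>n. 1 / real (p n)" 0 "n0 + L" "K * L"]
      by (simp add: atLeast0LessThan add.commute)
    also have "\<dots> = (\<Sum>k<K. \<Sum>n\<in>{k * L..<k * L + L}. 1 / real (p (n + (n0 + L))))"
      by (rule sum.nat_group[symmetric])
    also have "\<dots> \<le> (\<Sum>k<K. \<Sum>n\<in>{k * L..<k * L + L}. 384 * defect X (M k))"
    proof (intro sum_mono)
      fix k n assume "n \<in> {k * L..<k * L + L}"
      then have "p (n0 + k * L + L) \<le> p (n + (n0 + L))" by (simp add: p_le)
      then have "1 / real (p (n + (n0 + L))) \<le> 1 / real (p (n0 + k * L + L))"
        using p0 by (intro divide_left_mono) auto
      also have "\<dots> \<le> 384 * defect X (M k)" using large_defect[of k] by simp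
      finally show "1 / real (p (n + (n0 + L))) \<le> 384 * defect X (M k)" .
    qed
    also have "\<dots> = 384 * real L * (\<Sum>k<K. defect X (M k))"
      by (simp flip: sum_distrib_left)
    also have "\<dots> \<le> 384 * real L * (3 * real N / real (card X))"
      using sum_defect by (intro mult_left_mono) auto
    finally show ?thesis by simp
  qed
  have "ln (ln (real y)) - ln 2 \<le> (\<Sum>q | prime q \<and> q \<le> y. 1 / real q)"
    using y by (rule sum_prime_reciprocals_ge)
  also have "\<dots> = (\<Sum>n<\<pi>. 1 / real (p n))"
    unfolding primes_eq by (simp add: sum.reindex p_inj)
  also have "\<dots> \<le> (\<Sum>n\<in>{..<n0 + L} \<union> {n0 + L..<n0 + L + K * L}. 1 / real (p n))"
  proof (rule sum_mono2)
    have "\<pi> - n0 \<le> K * L + L"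
    proof -
      have "(\<pi> - n0) mod L < L" using L by simp
      then show ?thesis using div_mult_mod_eq[of "\<pi> - n0" L] unfolding K_def by linarith
    qed
    then show "{..<\<pi>} \<subseteq> {..<n0 + L} \<union> {n0 + L..<n0 + L + K * L}" by auto
  qed auto
  also have "\<dots> = (\<Sum>n<n0 + L. 1 / real (p n)) + (\<Sum>n\<in>{n0 + L..<n0 + L + K * L}. 1 / real (p n))"
    by (rule sum.union_disjoint) auto
  also have "(\<Sum>n<n0 + L. 1 / real (p n)) \<le> (\<Sum>n<n0 + L. 1)"
  proof (rule sum_mono)
    fix n
    have "p n \<ge> 1" using p_prime[of n] by (simp add: prime_gt_0_nat Suc_le_eq)
    then show "1 / real (p n) \<le> 1" by simp
  qed
  finally have "ln (ln (real y)) - ln 2 \<le> real n0 + real L + (\<Sum>n\<in>{n0 + L..<n0 + L + K * L}. 1 / real (p n))"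
    by simp
  moreover have "ln 2 \<le> (1 :: real)" using ln_le_minus_one[of "2 :: real"] by simp
  ultimately show False using tail large by linarith
qed

section \<open>Counting solutions modulo a block of primes\<close>

text \<open>
  For \<open>q\<close> of size at least \<open>(256 * L)\<^sup>2\<close> the square-root error term is at most \<open>q\<^sup>2 / (4 * L)\<close>; the lower bound
  also absorbs the difference between \<open>(q - 1) ^ 3\<close> and \<open>q ^ 3\<close>.
\<close>
lemma local_count_bounds:
  fixes L q s :: nat
  assumes "prime q" "L \<ge> 1" "(256 * L)\<^sup>2 \<le> q"
  shows "real (local_count q s) \<le> (real q)\<^sup>2 * (1 + 1 / (4 * real L))"
    and "real (local_count q s) \<ge> (real q)\<^sup>2 * (1 - 1 / (2 * real L))"
proof -
  have q: "real q > 0" using assms by (simp add: prime_gt_0_nat)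
  have "real ((256 * L)\<^sup>2) \<le> real q" using assms(3) by (simp only: of_nat_le_iff)
  then have "(256 * real L)\<^sup>2 \<le> real q" by simp
  then have sq: "256 * real L \<le> sqrt (real q)" by (rule real_le_rsqrt)
  have L: "real L \<ge> 1" using assms(2) by simp
  have "256 * real L * sqrt (real q) \<le> sqrt (real q) * sqrt (real q)"
    using sq by (intro mult_right_mono) auto
  then have "64 * sqrt (real q) \<le> real q * (1 / (4 * real L))"
    using L by (simp add: field_simps)
  then have "real q * real q * (64 * sqrt (real q)) \<le> real q * real q * (real q * (1 / (4 * real L)))"
    by (intro mult_left_mono) auto
  then have err: "64 * real q * (real q * sqrt (real q)) \<le> real q * ((real q)\<^sup>2 * (1 / (4 * real L)))"
    by (simp add: power2_eq_square mult_ac)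
  have approx: "\<bar>real q * real (local_count q s) - (real q - 1) ^ 3\<bar> \<le> real q * ((real q)\<^sup>2 * (1 / (4 * real L)))"
    using local_count_approx[OF assms(1), of s] err by linarith
  have "(real q - 1) ^ 3 \<le> real q ^ 3"
    using assms(1) prime_gt_0_nat[of q] by (intro power_mono) auto
  then have "real q * real (local_count q s) \<le> real q * ((real q)\<^sup>2 * (1 + 1 / (4 * real L)))"
    using approx by (simp add: power3_eq_cube power2_eq_square algebra_simps)
  then show "real (local_count q s) \<le> (real q)\<^sup>2 * (1 + 1 / (4 * real L))"
    using q by simp
  have "12 * real L \<le> real q"
  proof -
    have "12 * real L \<le> (256 * real L) * 1" using L by simp
    also have "\<dots> \<le> (256 * real L) * (256 * real L)" using L by (intro mult_left_mono) auto
    also have "\<dots> \<le> real q" using \<open>(256 * real L)\<^sup>2 \<le> real q\<close> by (simp add: power2_eq_square)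
    finally show ?thesis .
  qed
  then have "3 \<le> real q * (1 / (4 * real L))" using L by (simp add: field_simps)
  then have "real q * real q * 3 \<le> real q * real q * (real q * (1 / (4 * real L)))"
    by (intro mult_left_mono) auto
  moreover have "(real q - 1) ^ 3 \<ge> real q ^ 3 - real q * real q * 3"
  proof -
    have "(real q - 1) ^ 3 = real q ^ 3 - real q * real q * 3 + (3 * real q - 1)"
      by (simp add: power3_eq_cube algebra_simps)
    moreover have "3 * real q - 1 \<ge> 0" using \<open>12 * real L \<le> real q\<close> L by linarith
    ultimately show ?thesis by linarith
  qed
  moreover have "real q * ((real q)\<^sup>2 * (1 - 1 / (2 * real L)))
      = real q ^ 3 - 2 * (real q * real q * (real q * (1 / (4 * real L))))"
    by (simp add: power3_eq_cube power2_eq_square algebra_simps)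
  moreover have "real q * ((real q)\<^sup>2 * (1 / (4 * real L))) = real q * real q * (real q * (1 / (4 * real L)))"
    by (simp add: power2_eq_square)
  ultimately have "real q * ((real q)\<^sup>2 * (1 - 1 / (2 * real L))) \<le> real q * real (local_count q s)"
    using approx by linarith
  then show "real (local_count q s) \<ge> (real q)\<^sup>2 * (1 - 1 / (2 * real L))"
    using q by simp
qed

lemma card_multiples_lessThan:
  fixes m M :: nat
  assumes "m > 0" "m dvd M"
  shows "card {b \<in> {..<M}. m dvd b} = M div m"
proof -
  obtain k where k: "M = m * k" using assms(2) by blast
  have "{b \<in> {..<M}. m dvd b} = {b \<in> {..<m * k}. b mod m = 0}" using k by auto
  then show ?thesis using card_residue_class[of 0 m k] assms k by simp
qed

lemma prod_dvd_of_coprime: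
  fixes f :: "'i \<Rightarrow> nat"
  assumes "finite B" "\<And>i j. i \<in> B \<Longrightarrow> j \<in> B \<Longrightarrow> i \<noteq> j \<Longrightarrow> coprime (f i) (f j)"
    and "\<And>i. i \<in> B \<Longrightarrow> f i dvd n"
  shows "(\<Prod>i\<in>B. f i) dvd n"
  using assms
proof (induction B rule: finite_induct)
  case (insert j B)
  have "coprime (f j) (\<Prod>i\<in>B. f i)"
    using insert.hyps by (intro prod_coprime_right insert.prems(1)) auto
  then show ?case
    using insert by (simp add: divides_mult)
qed simp

definition admissible :: "nat set \<Rightarrow> nat \<Rightarrow> nat \<Rightarrow> bool" where
  "admissible B p b \<longleftrightarrow> p dvd b \<and> (\<forall>q\<in>B - {p}. \<not> q dvd b)"

text \<open>
  The lower bound for the primes makes the relative error of each local count at most \<open>1 / (2 * L)\<close>,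
  so that a product of \<open>L\<close> local counts deviates from its main term by a bounded factor.
\<close>
locale prime_block =
  fixes L :: nat and B :: "nat set"
  assumes L: "L \<ge> 1" and finite_B: "finite B" and card_B: "card B \<le> L"
    and prime_B: "\<And>q. q \<in> B \<Longrightarrow> prime q"
    and large_B: "\<And>q. q \<in> B \<Longrightarrow> (256 * L)\<^sup>2 \<le> q"
begin

definition D :: nat where "D = \<Prod>B"

lemma D_pos: "D > 0"
  unfolding D_def using finite_B prime_B by (intro prod_pos) (auto simp: prime_gt_0_nat)

lemma D4_eq: "D ^ 4 = (\<Prod>q\<in>B. q ^ 4)"
  by (simp add: D_def prod_power_distrib)

lemma coprime_B: "q \<in> B \<Longrightarrow> r \<in> B \<Longrightarrow> q \<noteq> r \<Longrightarrow> coprime (q ^ k) (r ^ k)"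
  using prime_B by (simp add: primes_coprime)

lemma not_2: "q \<in> B \<Longrightarrow> q \<noteq> 2"
proof
  assume q: "q \<in> B" "q = 2"
  have "(256 * 1 :: nat)\<^sup>2 \<le> (256 * L)\<^sup>2" using L by (intro power_mono) auto
  then show False using large_B[OF q(1)] q(2) by simp
qed

text \<open>
  At \<open>p\<close> the divisibility by \<open>p ^ 4\<close> of the sum of fourth powers is automatic.
\<close>
fun local_condition :: "nat \<Rightarrow> nat \<Rightarrow> nat \<Rightarrow> nat \<times> nat \<times> nat \<Rightarrow> bool" where
  "local_condition p s q (x, y, z) \<longleftrightarrow>
     (if q = p then p dvd x \<and> p dvd y \<and> p dvd z else unit_solution s q (x, y, z))"

text \<open>
  The triples that complete \<open>a\<close> to an admissible solution modulo \<open>D ^ 4\<close>. A uniform count of them for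
  every \<open>a\<close> controls both the number of all solutions and the number of solutions with an
  exceptional coordinate.
\<close>
definition completions :: "nat \<Rightarrow> nat \<Rightarrow> (nat \<times> nat \<times> nat) set" where
  "completions p a = {(x, y, z) \<in> cube (D ^ 4). admissible B p x \<and> admissible B p y \<and> admissible B p z
     \<and> D ^ 4 dvd a ^ 4 + x ^ 4 + y ^ 4 + z ^ 4}"

lemma completions_eq:
  assumes "p \<in> B" "admissible B p a"
  shows "completions p a = {v \<in> cube (\<Prod>q\<in>B. q ^ 4). \<forall>q\<in>B. local_condition p (a ^ 4) q v}"
proof -
  have iff: "(admissible B p x \<and> admissible B p y \<and> admissible B p z \<and> D ^ 4 dvd a ^ 4 + x ^ 4 + y ^ 4 + z ^ 4)
      \<longleftrightarrow> (\<forall>q\<in>B. local_condition p (a ^ 4) q (x, y, z))" (is "?l \<longleftrightarrow> ?r") for x y z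
  proof
    assume l: ?l
    show ?r
    proof
      fix q assume q: "q \<in> B"
      have "q ^ 4 dvd D ^ 4" unfolding D_def using q finite_B by (intro dvd_power_same dvd_prodI)
      moreover have "D ^ 4 dvd x ^ 4 + y ^ 4 + z ^ 4 + a ^ 4"
        using l by (simp add: add_ac)
      ultimately have "q ^ 4 dvd x ^ 4 + y ^ 4 + z ^ 4 + a ^ 4"
        by (rule dvd_trans)
      then show "local_condition p (a ^ 4) q (x, y, z)"
        using l q by (auto simp: admissible_def)
    qed
  next
    assume r: ?r
    have p: "p dvd x" "p dvd y" "p dvd z" using r assms(1) by fastforce+
    have u: "unit_solution (a ^ 4) q (x, y, z)" if "q \<in> B" "q \<noteq> p" for q
      using r that by fastforce
    have "(\<Prod>q\<in>B. q ^ 4) dvd a ^ 4 + x ^ 4 + y ^ 4 + z ^ 4"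
    proof (rule prod_dvd_of_coprime[OF finite_B])
      fix q assume q: "q \<in> B"
      show "q ^ 4 dvd a ^ 4 + x ^ 4 + y ^ 4 + z ^ 4"
      proof (cases "q = p")
        case True
        then show ?thesis using p assms(2) by (intro dvd_add dvd_power_same) (auto simp: admissible_def)
      next
        case False
        then have "q ^ 4 dvd x ^ 4 + y ^ 4 + z ^ 4 + a ^ 4" using u[OF q] by simp
        then show ?thesis by (simp add: add_ac)
      qed
    qed (rule coprime_B)
    then show ?l using p u by (auto simp: admissible_def D4_eq)
  qed
  show ?thesis unfolding completions_def D4_eq[symmetric] using iff by auto
qed

lemma card_completions:
  assumes "p \<in> B" "admissible B p a"
  shows "card (completions p a) = p ^ 9 * (\<Prod>q\<in>B - {p}. q ^ 6 * local_count q (a ^ 4))"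
proof -
  have "card (completions p a) = (\<Prod>q\<in>B. card {v \<in> cube (q ^ 4). local_condition p (a ^ 4) q v})"
    unfolding completions_eq[OF assms]
  proof (rule card_cube_crt[OF finite_B])
    fix q assume q: "q \<in> B"
    show "q ^ 4 > 0" using prime_B[OF q] by (simp add: prime_gt_0_nat)
    fix v :: "nat \<times> nat \<times> nat"
    obtain x y z where v: "v = (x, y, z)" by (cases v) auto
    have d: "q dvd w mod q ^ 4 \<longleftrightarrow> q dvd w" for w by (rule dvd_mod_iff) simp
    have "q ^ 4 dvd (x mod q ^ 4) ^ 4 + (y mod q ^ 4) ^ 4 + (z mod q ^ 4) ^ 4 + a ^ 4
        \<longleftrightarrow> q ^ 4 dvd x ^ 4 + y ^ 4 + z ^ 4 + a ^ 4"
      by (intro cong_dvd_iff cong_add cong_pow) auto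
    then show "local_condition p (a ^ 4) q (mod3 v (q ^ 4)) = local_condition p (a ^ 4) q v"
      using d by (auto simp: v)
  qed (rule coprime_B)
  also have "\<dots> = card {v \<in> cube (p ^ 4). local_condition p (a ^ 4) p v}
      * (\<Prod>q\<in>B - {p}. card {v \<in> cube (q ^ 4). local_condition p (a ^ 4) q v})"
    using assms(1) by (intro prod.remove finite_B)
  also have "card {v \<in> cube (p ^ 4). local_condition p (a ^ 4) p v} = p ^ 9"
  proof -
    have p: "p > 0" using prime_B[OF assms(1)] by (simp add: prime_gt_0_nat)
    define S where "S = {b \<in> {..<p ^ 4}. p dvd b}"
    have "p ^ 4 = p * p ^ 3" using power_Suc[of p 3] by simp
    then have "card S = p ^ 3"
      unfolding S_def using p by (subst card_multiples_lessThan) auto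
    moreover have "{v \<in> cube (p ^ 4). local_condition p (a ^ 4) p v} = S \<times> S \<times> S"
      by (auto simp: cube_def S_def)
    ultimately show ?thesis by (simp add: card_cartesian_product flip: power_add)
  qed
  also have "(\<Prod>q\<in>B - {p}. card {v \<in> cube (q ^ 4). local_condition p (a ^ 4) q v})
      = (\<Prod>q\<in>B - {p}. q ^ 6 * local_count q (a ^ 4))"
  proof (intro prod.cong refl)
    fix q assume q: "q \<in> B - {p}"
    have "{v \<in> cube (q ^ 4). local_condition p (a ^ 4) q v} = {v \<in> cube (q ^ 4). unit_solution (a ^ 4) q v}"
      using q by auto
    then show "card {v \<in> cube (q ^ 4). local_condition p (a ^ 4) q v} = q ^ 6 * local_count q (a ^ 4)"
      using card_unit_solutions[of q] prime_B not_2 q by simp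
  qed
  finally show ?thesis .
qed

text \<open>
  The expected number is \<open>p ^ 9\<close> from the prime \<open>p\<close>, where every triple of multiples of \<open>p\<close> is
  allowed, times \<open>q ^ 8\<close> from each other prime \<open>q\<close>, that is \<open>p * D ^ 8\<close>.
\<close>
lemma card_completions_bounds:
  assumes "p \<in> B" "admissible B p a"
  shows "real (card (completions p a)) \<le> 3 * (real p * real D ^ 8)"
    and "real (card (completions p a)) \<ge> (real p * real D ^ 8) / 2"
proof -
  define \<rho> where "\<rho> q = real (local_count q (a ^ 4)) / (real q)\<^sup>2" for q
  define R where "R = (\<Prod>q\<in>B - {p}. \<rho> q)"
  have p0: "real p > 0" using prime_B[OF assms(1)] by (simp add: prime_gt_0_nat)
  have D: "real D = real p * (\<Prod>q\<in>B - {p}. real q)"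
    unfolding D_def using assms(1) finite_B by (simp add: prod.remove)
  have "real (card (completions p a)) = real p ^ 9 * (\<Prod>q\<in>B - {p}. real q ^ 8 * \<rho> q)"
  proof -
    have "real q ^ 6 * real (local_count q (a ^ 4)) = real q ^ 8 * \<rho> q" if "q \<in> B - {p}" for q
    proof -
      have ne: "(real q)\<^sup>2 \<noteq> 0" using prime_B that by force
      have "real q ^ 8 = real q ^ 6 * (real q)\<^sup>2" by (simp flip: power_add)
      then show ?thesis
        using nonzero_mult_div_cancel_left[OF ne, of "real (local_count q (a ^ 4))"]
        by (simp only: \<rho>_def mult.assoc times_divide_eq_right[symmetric])
    qed
    then show ?thesis unfolding card_completions[OF assms] by simp
  qed
  also have "\<dots> = real p ^ 9 * (\<Prod>q\<in>B - {p}. real q) ^ 8 * R"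
    by (simp add: prod.distrib R_def prod_power_distrib)
  also have "real p ^ 9 * (\<Prod>q\<in>B - {p}. real q) ^ 8 = real p * real D ^ 8"
    unfolding D power_mult_distrib using power_Suc[of "real p" 8] by simp
  finally have eq: "real (card (completions p a)) = real p * real D ^ 8 * R" .
  have Lr: "real L \<ge> 1" using L by simp
  have bounds: "1 - 1 / (2 * real L) \<le> \<rho> q" "\<rho> q \<le> 1 + 1 / (4 * real L)" if "q \<in> B - {p}" for q
  proof -
    have "real q > 0" using prime_B that by (simp add: prime_gt_0_nat)
    then show "1 - 1 / (2 * real L) \<le> \<rho> q" "\<rho> q \<le> 1 + 1 / (4 * real L)"
      using local_count_bounds[OF prime_B L large_B, of q "a ^ 4"] that
      by (simp_all add: \<rho>_def pos_le_divide_eq pos_divide_le_eq mult.commute)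
  qed
  have c: "card (B - {p}) \<le> L"
    using card_B card_Diff1_le[of B p] by linarith
  have half: "1 - 1 / (2 * real L) \<ge> 1 / 2" using Lr by (simp add: field_simps)
  have "0 \<le> \<rho> q" for q by (simp add: \<rho>_def)
  then have "R \<le> (\<Prod>q\<in>B - {p}. 1 + 1 / (4 * real L))"
    unfolding R_def using bounds by (intro prod_mono) auto
  also have "\<dots> = (1 + 1 / (4 * real L)) ^ card (B - {p})" by simp
  also have "\<dots> \<le> (1 + 1 / (4 * real L)) ^ L"
    using c Lr by (intro power_increasing) auto
  also have "\<dots> \<le> exp (1 / (4 * real L)) ^ L"
    using Lr by (intro power_mono exp_ge_add_one_self) auto
  also have "\<dots> = exp (1 / 4)" using Lr by (simp flip: exp_of_nat_mult)
  also have "\<dots> \<le> exp 1" by simp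
  also have "\<dots> \<le> 3" by (rule exp_le)
  finally have "R \<le> 3" .
  then have "real p * real D ^ 8 * R \<le> real p * real D ^ 8 * 3"
    by (intro mult_left_mono) auto
  then show "real (card (completions p a)) \<le> 3 * (real p * real D ^ 8)" using eq by simp
  have "1 / 2 \<le> 1 + real L * (- (1 / (2 * real L)))" using Lr by simp
  also have "\<dots> \<le> (1 + (- (1 / (2 * real L)))) ^ L"
    using Lr half by (intro Bernoulli_inequality) auto
  also have "\<dots> = (1 - 1 / (2 * real L)) ^ L" by simp
  also have "\<dots> \<le> (1 - 1 / (2 * real L)) ^ card (B - {p})"
    using c half Lr by (intro power_decreasing) auto
  also have "\<dots> = (\<Prod>q\<in>B - {p}. 1 - 1 / (2 * real L))" by simp
  also have "\<dots> \<le> R"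
    unfolding R_def
  proof (rule prod_mono)
    fix q assume "q \<in> B - {p}"
    then show "0 \<le> 1 - 1 / (2 * real L) \<and> 1 - 1 / (2 * real L) \<le> \<rho> q"
      using bounds half by simp
  qed
  finally have "1 / 2 \<le> R" .
  then have "real p * real D ^ 8 * (1 / 2) \<le> real p * real D ^ 8 * R"
    by (intro mult_left_mono) auto
  then show "real (card (completions p a)) \<ge> (real p * real D ^ 8) / 2" using eq by simp
qed

text \<open>
  The multiples of \<open>p\<close> that are also multiples of another prime of the block are a minority, since the
  primes are much larger than their number.
\<close>
lemma card_admissible:
  assumes "p \<in> B"
  shows "real (card {b \<in> {..<D ^ 4}. admissible B p b}) \<ge> real D ^ 4 / (2 * real p)"
proof -
  define S where "S = {b \<in> {..<D ^ 4}. p dvd b}"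
  define V where "V q = {b \<in> {..<D ^ 4}. p * q dvd b}" for q
  have p0: "p > 0" using prime_B[OF assms] by (simp add: prime_gt_0_nat)
  have D_dvd: "D dvd D ^ 4" by simp
  have dvd_D: "q dvd D" if "q \<in> B" for q
    unfolding D_def using that finite_B by (metis dvd_prodI)
  have cS: "real (card S) = real D ^ 4 / real p"
  proof -
    have "p dvd D ^ 4" by (rule dvd_trans[OF dvd_D[OF assms] D_dvd])
    then show ?thesis unfolding S_def card_multiples_lessThan[OF p0 \<open>p dvd D ^ 4\<close>] by (simp add: real_of_nat_div)
  qed
  have cV: "real (card (V q)) = real D ^ 4 / (real p * real q)" if "q \<in> B - {p}" for q
  proof -
    have "coprime p q" using that assms prime_B by (intro primes_coprime) auto
    then have "p * q dvd D" using dvd_D assms that by (intro divides_mult) auto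
    then have "p * q dvd D ^ 4" using D_dvd by (rule dvd_trans)
    moreover have "p * q > 0" using prime_B that p0 by (simp add: prime_gt_0_nat)
    ultimately show ?thesis unfolding V_def by (subst card_multiples_lessThan) (simp_all add: real_of_nat_div)
  qed
  have "S - (\<Union>q\<in>B - {p}. V q) \<subseteq> {b \<in> {..<D ^ 4}. admissible B p b}"
  proof
    fix b assume b: "b \<in> S - (\<Union>q\<in>B - {p}. V q)"
    have "\<not> q dvd b" if "q \<in> B - {p}" for q
    proof
      assume "q dvd b"
      moreover have "coprime p q" using that assms prime_B by (intro primes_coprime) auto
      ultimately have "p * q dvd b" using b by (simp add: S_def divides_mult)
      then show False using b that by (auto simp: V_def S_def)
    qed
    then show "b \<in> {b \<in> {..<D ^ 4}. admissible B p b}" using b by (simp add: S_def admissible_def)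
  qed
  then have "card (S - (\<Union>q\<in>B - {p}. V q)) \<le> card {b \<in> {..<D ^ 4}. admissible B p b}"
    by (intro card_mono) auto
  moreover have "card S \<le> card (S - (\<Union>q\<in>B - {p}. V q)) + card (\<Union>q\<in>B - {p}. V q)"
  proof -
    have "finite (\<Union>q\<in>B - {p}. V q)" using finite_B by (auto simp: V_def)
    from diff_card_le_card_Diff[OF this, of S] show ?thesis by linarith
  qed
  moreover have "card (\<Union>q\<in>B - {p}. V q) \<le> (\<Sum>q\<in>B - {p}. card (V q))"
    using finite_B by (intro card_UN_le) auto
  ultimately have "card S \<le> card {b \<in> {..<D ^ 4}. admissible B p b} + (\<Sum>q\<in>B - {p}. card (V q))"
    by linarith
  then have "real (card S) \<le> real (card {b \<in> {..<D ^ 4}. admissible B p b}) + (\<Sum>q\<in>B - {p}. real (card (V q)))"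
    by (metis of_nat_add of_nat_le_iff of_nat_sum)
  also have "(\<Sum>q\<in>B - {p}. real (card (V q))) \<le> (\<Sum>q\<in>B - {p}. real D ^ 4 / real p * (1 / (2 * real L)))"
  proof (intro sum_mono)
    fix q assume q: "q \<in> B - {p}"
    have "2 * L * 1 \<le> 2 * L * L" using L by (intro mult_le_mono2) auto
    also have "\<dots> \<le> (256 * L)\<^sup>2" by (simp add: power2_eq_square)
    also have "\<dots> \<le> q" using large_B q by auto
    finally have "2 * real L \<le> real q" by linarith
    then have "1 / real q \<le> 1 / (2 * real L)" using L by (intro divide_left_mono) auto
    then have "real D ^ 4 / real p * (1 / real q) \<le> real D ^ 4 / real p * (1 / (2 * real L))"
      by (intro mult_left_mono) auto
    then show "real (card (V q)) \<le> real D ^ 4 / real p * (1 / (2 * real L))"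
      using cV[OF q] by simp
  qed
  also have "\<dots> = real (card (B - {p})) * (real D ^ 4 / real p * (1 / (2 * real L)))" by simp
  also have "\<dots> \<le> real L * (real D ^ 4 / real p * (1 / (2 * real L)))"
    using card_B card_Diff1_le[of B p] by (intro mult_right_mono) auto
  also have "\<dots> = real D ^ 4 / (2 * real p)" using L by simp
  finally show ?thesis using cS by (simp add: field_simps)
qed

end

section \<open>Counting quadruples with divisible sum\<close>

definition divisible_quadruples :: "nat set \<Rightarrow> nat \<Rightarrow> (nat \<times> nat \<times> nat \<times> nat) set" where
  "divisible_quadruples X M =
     {(a, b, c, d) \<in> X \<times> X \<times> X \<times> X. M dvd a ^ 4 + b ^ 4 + c ^ 4 + d ^ 4}"

context prime_block
begin

definition admissible_quadruples :: "nat set \<Rightarrow> nat \<Rightarrow> (nat \<times> nat \<times> nat \<times> nat) set" where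
  "admissible_quadruples X p =
     {(a, b, c, d) \<in> divisible_quadruples X (D ^ 4).
        admissible B p a \<and> admissible B p b \<and> admissible B p c \<and> admissible B p d}"

text \<open>
  Call a class exceptional if it contains fewer than half of the average number of elements
  of \<open>X\<close>. By Chebyshev's inequality the defect bounds the number of exceptional classes. By the uniform
  bound on completions they meet at most half of the solutions modulo \<open>D ^ 4\<close>, and each
  remaining solution is realised by at least \<open>(\<mu> / 2) ^ 4\<close> quadruples of \<open>X\<close>, where \<open>\<mu>\<close> is the average.
\<close>
lemma card_admissible_quadruples:
  assumes X: "finite X" "X \<noteq> {}" and p: "p \<in> B"
    and defect: "defect X (D ^ 4) \<le> 1 / (384 * real p)"
  shows "real (card (admissible_quadruples X p)) \<ge> real (card X) ^ 4 / (128 * real D ^ 4)"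
proof -
  define M where "M = D ^ 4"
  have M0: "M > 0" using D_pos by (simp add: M_def)
  have M8: "real D ^ 8 = real M ^ 2" by (simp add: M_def flip: power_mult)
  have p0: "real p > 0" using prime_B[OF p] by (simp add: prime_gt_0_nat)
  define c where "c = real (card X)"
  have c0: "c > 0" using X by (simp add: c_def card_gt_0_iff)
  define \<mu> where "\<mu> = c / real M"
  have \<mu>0: "\<mu> > 0" using c0 M0 by (simp add: \<mu>_def)
  define R where "R b = {n \<in> X. n mod M = b}" for b
  have fR: "finite (R b)" for b using X by (simp add: R_def)
  define \<alpha> where "\<alpha> b = real (card (R b))" for b
  define A where "A = {b \<in> {..<M}. admissible B p b}"
  define H where "H = {b \<in> A. \<alpha> b < \<mu> / 2}"
  have fA: "finite A" by (simp add: A_def)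
  have fH: "finite H" using fA by (simp add: H_def)
  have fC: "finite (completions p a)" for a
    by (rule finite_subset[of _ "cube (D ^ 4)"]) (auto simp: completions_def cube_def)
  have card_H: "real (card H) \<le> real M / (96 * real p)"
  proof -
    have "real (card H) * (\<mu> / 2)\<^sup>2 = (\<Sum>b\<in>H. (\<mu> / 2)\<^sup>2)" by simp
    also have "\<dots> \<le> (\<Sum>b\<in>H. (\<alpha> b - \<mu>)\<^sup>2)"
    proof (rule sum_mono)
      fix b assume "b \<in> H"
      then have "\<mu> / 2 \<le> \<mu> - \<alpha> b" by (simp add: H_def)
      then have "(\<mu> / 2)\<^sup>2 \<le> (\<mu> - \<alpha> b)\<^sup>2" using \<mu>0 by (intro power_mono) auto
      then show "(\<mu> / 2)\<^sup>2 \<le> (\<alpha> b - \<mu>)\<^sup>2" by (simp only: power2_commute)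
    qed
    also have "\<dots> \<le> (\<Sum>b<M. (\<alpha> b - \<mu>)\<^sup>2)"
      by (rule sum_mono2) (auto simp: H_def A_def)
    also have "\<dots> = defect X M * c\<^sup>2 / real M"
      using c0 M0 by (simp add: defect_def residue_count_def \<alpha>_def R_def \<mu>_def c_def)
    also have "\<dots> \<le> (1 / (384 * real p)) * c\<^sup>2 / real M"
      using defect unfolding M_def by (intro divide_right_mono mult_right_mono) auto
    also have "\<dots> = (real M / (96 * real p)) * (\<mu> / 2)\<^sup>2"
      using M0 by (simp add: \<mu>_def power2_eq_square field_simps)
    finally have "real (card H) * (\<mu> / 2)\<^sup>2 \<le> (real M / (96 * real p)) * (\<mu> / 2)\<^sup>2" .
    moreover have "(\<mu> / 2)\<^sup>2 > 0" using \<mu>0 by (intro zero_less_power) simp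
    ultimately show ?thesis by (rule mult_right_le_imp_le)
  qed
  define E where "E = (SIGMA a:A. completions p a)"
  define F where "F = (SIGMA a:H. completions p a)"
  have fE: "finite E" and fF: "finite F" using fA fH fC by (simp_all add: E_def F_def)
  have card_E: "real (card E) \<ge> real M ^ 3 / 4"
  proof -
    have "real M ^ 3 / 4 = (real M / (2 * real p)) * (real p * real M ^ 2 / 2)"
      using p0 by (simp add: power3_eq_cube power2_eq_square)
    also have "\<dots> \<le> real (card A) * (real p * real M ^ 2 / 2)"
      using card_admissible[OF p] by (intro mult_right_mono) (auto simp: A_def M_def)
    also have "\<dots> = (\<Sum>a\<in>A. real p * real M ^ 2 / 2)" by simp
    also have "\<dots> \<le> (\<Sum>a\<in>A. real (card (completions p a)))"
      using card_completions_bounds(2)[OF p] M8 by (intro sum_mono) (simp add: A_def)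
    also have "\<dots> = real (card E)" using fA fC by (simp add: E_def)
    finally show ?thesis .
  qed
  have card_F: "real (card F) \<le> real M ^ 3 / 32"
  proof -
    have "real (card F) = (\<Sum>a\<in>H. real (card (completions p a)))" using fH fC by (simp add: F_def)
    also have "\<dots> \<le> (\<Sum>a\<in>H. 3 * (real p * real M ^ 2))"
      using card_completions_bounds(1)[OF p] M8 by (intro sum_mono) (simp add: A_def H_def)
    also have "\<dots> = real (card H) * (3 * (real p * real M ^ 2))" by simp
    also have "\<dots> \<le> (real M / (96 * real p)) * (3 * (real p * real M ^ 2))"
      using card_H by (intro mult_right_mono) auto
    also have "\<dots> = real M ^ 3 / 32" using p0 by (simp add: power3_eq_cube power2_eq_square)
    finally show ?thesis .
  qed
  define G where "G = {(a, x, y, z) \<in> E. \<mu> / 2 \<le> \<alpha> a \<and> \<mu> / 2 \<le> \<alpha> x \<and> \<mu> / 2 \<le> \<alpha> y \<and> \<mu> / 2 \<le> \<alpha> z}"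
  have fG: "finite G" by (rule finite_subset[OF _ fE]) (auto simp: G_def)
  define s2 s3 s4 where "s2 = (\<lambda>(a :: nat, x :: nat, y :: nat, z :: nat). (x, a, y, z))"
    and "s3 = (\<lambda>(a :: nat, x :: nat, y :: nat, z :: nat). (y, x, a, z))"
    and "s4 = (\<lambda>(a :: nat, x :: nat, y :: nat, z :: nat). (z, x, y, a))"
  have E_iff: "(a, x, y, z) \<in> E \<longleftrightarrow> a \<in> A \<and> x \<in> A \<and> y \<in> A \<and> z \<in> A \<and> M dvd a ^ 4 + x ^ 4 + y ^ 4 + z ^ 4" for a x y z
    by (auto simp: E_def A_def completions_def cube_def M_def)
  have F_iff: "(a, x, y, z) \<in> F \<longleftrightarrow> a \<in> H \<and> (a, x, y, z) \<in> E" for a x y z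
    by (auto simp: F_def E_def H_def)
  \<comment> \<open>The swaps move an exceptional coordinate to the front, where \<open>card_completions_bounds\<close> applies.\<close>
  have "E \<subseteq> G \<union> (F \<union> (s2 ` F \<union> (s3 ` F \<union> s4 ` F)))"
  proof
    fix e assume e: "e \<in> E"
    obtain a x y z where eq: "e = (a, x, y, z)" by (cases e) auto
    have in_A: "a \<in> A" "x \<in> A" "y \<in> A" "z \<in> A" and dv: "M dvd a ^ 4 + x ^ 4 + y ^ 4 + z ^ 4"
      using e by (simp_all add: eq E_iff)
    have H_iff: "b \<in> H \<longleftrightarrow> \<not> \<mu> / 2 \<le> \<alpha> b" if "b \<in> A" for b
      using that by (simp add: H_def not_le)
    have "e \<in> G" if "a \<notin> H" "x \<notin> H" "y \<notin> H" "z \<notin> H"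
      using e that in_A H_iff unfolding G_def eq by simp
    then consider "e \<in> G" | "a \<in> H" | "x \<in> H" | "y \<in> H" | "z \<in> H" by blast
    then show "e \<in> G \<union> (F \<union> (s2 ` F \<union> (s3 ` F \<union> s4 ` F)))"
    proof cases
      case 2
      then show ?thesis using e by (simp add: eq F_iff)
    next
      case 3
      then have "(x, a, y, z) \<in> F" using in_A dv by (simp add: F_iff E_iff add_ac)
      moreover have "e = s2 (x, a, y, z)" by (simp add: eq s2_def)
      ultimately show ?thesis by blast
    next
      case 4
      then have "(y, x, a, z) \<in> F" using in_A dv by (simp add: F_iff E_iff add_ac)
      moreover have "e = s3 (y, x, a, z)" by (simp add: eq s3_def)
      ultimately show ?thesis by blast
    next
      case 5
      then have "(z, x, y, a) \<in> F" using in_A dv by (simp add: F_iff E_iff add_ac)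
      moreover have "e = s4 (z, x, y, a)" by (simp add: eq s4_def)
      ultimately show ?thesis by blast
    qed simp
  qed
  then have "card E \<le> card (G \<union> (F \<union> (s2 ` F \<union> (s3 ` F \<union> s4 ` F))))"
    using fG fF by (intro card_mono) auto
  also have "\<dots> \<le> card G + (card F + (card (s2 ` F) + (card (s3 ` F) + card (s4 ` F))))"
    by (intro order.trans[OF card_Un_le] add_mono order_refl)
  also have "\<dots> \<le> card G + (card F + (card F + (card F + card F)))"
    using fF by (intro add_mono card_image_le order_refl)
  finally have "real (card E) \<le> real (card G) + 4 * real (card F)" by linarith
  then have card_G: "real (card G) \<ge> real M ^ 3 / 8" using card_E card_F by linarith
  define fib where "fib = (\<lambda>(a, x, y, z). R a \<times> R x \<times> R y \<times> R z)"
  have "(\<Union>e\<in>G. fib e) \<subseteq> admissible_quadruples X p"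
  proof
    fix w assume "w \<in> (\<Union>e\<in>G. fib e)"
    then obtain a x y z where e: "(a, x, y, z) \<in> E" and w: "w \<in> R a \<times> R x \<times> R y \<times> R z"
      by (auto simp: G_def fib_def)
    obtain n1 n2 n3 n4 where wn: "w = (n1, n2, n3, n4)" by (cases w) auto
    have adm: "admissible B p n" if "n \<in> R b" "b \<in> A" for n b
    proof -
      have "q dvd n \<longleftrightarrow> q dvd b" if "q \<in> B" for q
      proof -
        have "q dvd D" unfolding D_def using that finite_B by (metis dvd_prodI)
        then have "q dvd M" unfolding M_def by (rule dvd_trans) simp
        moreover have "b = n mod M" using \<open>n \<in> R b\<close> by (simp add: R_def)
        ultimately show ?thesis by (simp add: dvd_mod_iff)
      qed
      then show ?thesis using \<open>b \<in> A\<close> p by (simp add: admissible_def A_def)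
    qed
    have "[n1 ^ 4 + n2 ^ 4 + n3 ^ 4 + n4 ^ 4 = a ^ 4 + x ^ 4 + y ^ 4 + z ^ 4] (mod M)"
      using w by (intro cong_add cong_pow) (auto simp: wn R_def)
    then have "M dvd n1 ^ 4 + n2 ^ 4 + n3 ^ 4 + n4 ^ 4"
      using e by (simp add: E_iff cong_dvd_iff)
    then show "w \<in> admissible_quadruples X p"
      using w e adm by (auto simp: admissible_quadruples_def divisible_quadruples_def wn E_iff M_def R_def)
  qed
  moreover have "finite (admissible_quadruples X p)"
    by (rule finite_subset[of _ "X \<times> X \<times> X \<times> X"])
      (use X in \<open>auto simp: admissible_quadruples_def divisible_quadruples_def\<close>)
  ultimately have "card (\<Union>e\<in>G. fib e) \<le> card (admissible_quadruples X p)"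
    by (intro card_mono)
  moreover have "card (\<Union>e\<in>G. fib e) = (\<Sum>e\<in>G. card (fib e))"
  proof (rule card_UN_disjoint[OF fG])
    show "\<forall>e\<in>G. finite (fib e)" using fR by (auto simp: fib_def)
    show "\<forall>e\<in>G. \<forall>e'\<in>G. e \<noteq> e' \<longrightarrow> fib e \<inter> fib e' = {}" by (auto simp: fib_def R_def)
  qed
  ultimately have "(\<Sum>e\<in>G. real (card (fib e))) \<le> real (card (admissible_quadruples X p))"
    by (metis of_nat_le_iff of_nat_sum)
  moreover have "(\<Sum>e\<in>G. (\<mu> / 2) ^ 4) \<le> (\<Sum>e\<in>G. real (card (fib e)))"
  proof (rule sum_mono)
    fix e assume "e \<in> G"
    then obtain a x y z where e: "e = (a, x, y, z)" "\<mu> / 2 \<le> \<alpha> a" "\<mu> / 2 \<le> \<alpha> x" "\<mu> / 2 \<le> \<alpha> y" "\<mu> / 2 \<le> \<alpha> z"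
      by (auto simp: G_def)
    have "(\<mu> / 2) ^ 4 = \<mu> / 2 * (\<mu> / 2 * (\<mu> / 2 * (\<mu> / 2)))" by (simp add: power4_eq_xxxx)
    also have "\<dots> \<le> \<alpha> a * (\<alpha> x * (\<alpha> y * \<alpha> z))"
      using e \<mu>0 by (intro mult_mono mult_nonneg_nonneg) auto
    also have "\<dots> = real (card (fib e))"
      by (simp add: e fib_def \<alpha>_def card_cartesian_product)
    finally show "(\<mu> / 2) ^ 4 \<le> real (card (fib e))" .
  qed
  moreover have "(\<Sum>e\<in>G. (\<mu> / 2) ^ 4) \<ge> real M ^ 3 / 8 * (\<mu> / 2) ^ 4"
  proof -
    have "real M ^ 3 / 8 * (\<mu> / 2) ^ 4 \<le> real (card G) * (\<mu> / 2) ^ 4"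
      using card_G \<mu>0 by (intro mult_right_mono) auto
    then show ?thesis by simp
  qed
  moreover have "real M ^ 3 / 8 * (\<mu> / 2) ^ 4 = c ^ 4 / (128 * real M)"
    using M0 by (simp add: \<mu>_def power_divide power3_eq_cube power4_eq_xxxx field_simps)
  ultimately show ?thesis by (simp add: c_def M_def)
qed

text \<open>
  Admissible quadruples for different primes of the block are different, because \<open>p\<close> divides the
  entries of the ones and not those of the others.
\<close>
lemma card_block_mult_le:
  assumes X: "finite X" "X \<noteq> {}"
    and defect: "\<And>p. p \<in> B \<Longrightarrow> defect X (D ^ 4) \<le> 1 / (384 * real p)"
  shows "real (card B) * (real (card X) ^ 4 / (128 * real D ^ 4)) \<le> real (card (divisible_quadruples X (D ^ 4)))"
proof -
  have fin: "finite (divisible_quadruples X (D ^ 4))"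
    by (rule finite_subset[of _ "X \<times> X \<times> X \<times> X"]) (use X in \<open>auto simp: divisible_quadruples_def\<close>)
  have sub: "admissible_quadruples X p \<subseteq> divisible_quadruples X (D ^ 4)" for p
    by (auto simp: admissible_quadruples_def)
  have "(\<Sum>p\<in>B. real (card X) ^ 4 / (128 * real D ^ 4)) \<le> (\<Sum>p\<in>B. real (card (admissible_quadruples X p)))"
    by (intro sum_mono card_admissible_quadruples X defect)
  also have "\<dots> = real (card (\<Union>p\<in>B. admissible_quadruples X p))"
  proof -
    have "card (\<Union>p\<in>B. admissible_quadruples X p) = (\<Sum>p\<in>B. card (admissible_quadruples X p))"
    proof (rule card_UN_disjoint[OF finite_B])
      show "\<forall>p\<in>B. finite (admissible_quadruples X p)" using finite_subset[OF sub fin] by blast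
      show "\<forall>p\<in>B. \<forall>q\<in>B. p \<noteq> q \<longrightarrow> admissible_quadruples X p \<inter> admissible_quadruples X q = {}"
        by (auto simp: admissible_quadruples_def admissible_def)
    qed
    then show ?thesis by simp
  qed
  also have "\<dots> \<le> real (card (divisible_quadruples X (D ^ 4)))"
    using fin sub by (simp only: of_nat_le_iff) (intro card_mono; blast)
  finally show ?thesis by simp
qed

end

lemma card_ordered_representations_le:
  assumes B: "is_B_set h g A"
  shows "finite {as. length as = h \<and> set as \<subseteq> A \<and> sum_list as = m}"
    and "card {as. length as = h \<and> set as \<subseteq> A \<and> sum_list as = m} \<le> fact h * g"
proof -
  define S where "S = {as. length as = h \<and> set as \<subseteq> A \<and> sum_list as = m}"
  define Q where "Q = rep_tuples A h m"
  have Q: "finite Q" "card Q \<le> g" using B by (auto simp: is_B_set_def rep_count_def Q_def)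
  have "S \<subseteq> (\<Union>bs\<in>Q. permutations_of_multiset (mset bs))"
  proof
    fix as assume "as \<in> S"
    moreover have "sum_list (sort as) = sum_list as"
      by (metis mset_sort sum_mset_sum_list)
    ultimately have "sort as \<in> Q" by (simp add: S_def Q_def rep_tuples_def)
    moreover have "as \<in> permutations_of_multiset (mset (sort as))"
      by (simp add: permutations_of_multiset_def)
    ultimately show "as \<in> (\<Union>bs\<in>Q. permutations_of_multiset (mset bs))" by blast
  qed
  moreover have fin: "finite (\<Union>bs\<in>Q. permutations_of_multiset (mset bs))"
    using Q by simp
  ultimately show "finite {as. length as = h \<and> set as \<subseteq> A \<and> sum_list as = m}"
    unfolding S_def[symmetric] by (rule finite_subset)
  have "card S \<le> card (\<Union>bs\<in>Q. permutations_of_multiset (mset bs))"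
    using fin \<open>S \<subseteq> _\<close> by (intro card_mono)
  also have "\<dots> \<le> (\<Sum>bs\<in>Q. card (permutations_of_multiset (mset bs)))"
    using Q by (intro card_UN_le)
  also have "\<dots> \<le> (\<Sum>bs\<in>Q. fact h)"
  proof (rule sum_mono)
    fix bs assume "bs \<in> Q"
    then have "size (mset bs) = h" by (simp add: Q_def rep_tuples_def)
    then show "card (permutations_of_multiset (mset bs)) \<le> fact h"
      unfolding card_permutations_of_multiset(1) by simp
  qed
  also have "\<dots> \<le> fact h * g" using Q by simp
  finally show "card {as. length as = h \<and> set as \<subseteq> A \<and> sum_list as = m} \<le> fact h * g"
    by (simp add: S_def)
qed

text \<open>
  A positive multiple of \<open>M\<close> that is a sum of four fourth powers of numbers up to \<open>N\<close> takes at most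
  \<open>4 * N ^ 4 / M\<close> values, and each value has at most \<open>g\<close> representations,
  each with at most \<open>4!\<close> orderings.
\<close>
lemma card_divisible_quadruples_le:
  assumes B: "is_B_set 4 g A" and X: "X \<subseteq> {1..N}" "\<And>n. n \<in> X \<Longrightarrow> int n ^ 4 \<in> A" and M: "M > 0"
  shows "real (card (divisible_quadruples X M)) \<le> 96 * real g * real N ^ 4 / real M"
proof -
  define S where "S m = {as. length as = 4 \<and> set as \<subseteq> A \<and> sum_list as = m}" for m
  define f where "f = (\<lambda>(a :: nat, b :: nat, c :: nat, d :: nat). [int a ^ 4, int b ^ 4, int c ^ 4, int d ^ 4])"
  define I where "I = {1..4 * N ^ 4 div M}"
  have "inj f"
  proof (rule injI)
    fix v w assume "f v = f w"
    moreover have "a = b" if "int a ^ 4 = int b ^ 4" for a b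
      using power_eq_imp_eq_base[OF that] by simp
    ultimately show "v = w" by (cases v; cases w) (auto simp: f_def)
  qed
  have sub: "f ` divisible_quadruples X M \<subseteq> (\<Union>k\<in>I. S (int (M * k)))"
  proof
    fix v assume "v \<in> f ` divisible_quadruples X M"
    then obtain a b c d where v: "v = f (a, b, c, d)" and mem: "a \<in> X" "b \<in> X" "c \<in> X" "d \<in> X"
      and "M dvd a ^ 4 + b ^ 4 + c ^ 4 + d ^ 4"
      by (auto simp: divisible_quadruples_def)
    then obtain k where k: "a ^ 4 + b ^ 4 + c ^ 4 + d ^ 4 = M * k" by blast
    have le: "n ^ 4 \<le> N ^ 4" if "n \<in> X" for n using X(1) that by (intro power_mono) auto
    have "M * k \<le> 4 * N ^ 4" unfolding k[symmetric]
      using le[OF mem(1)] le[OF mem(2)] le[OF mem(3)] le[OF mem(4)] by linarith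
    then have "k \<le> 4 * N ^ 4 div M" using M by (simp add: less_eq_div_iff_mult_less_eq mult.commute)
    moreover have "k > 0"
    proof (rule Nat.gr0I)
      assume "k = 0"
      then have "a = 0" using k by simp
      then show False using mem(1) X(1) by auto
    qed
    ultimately have "k \<in> I" by (simp add: I_def)
    have "sum_list v = int (a ^ 4 + b ^ 4 + c ^ 4 + d ^ 4)" by (simp add: v f_def)
    then have "sum_list v = int (M * k)" by (simp only: k)
    then have "v \<in> S (int (M * k))"
      using mem X(2) by (auto simp: S_def v f_def)
    then show "v \<in> (\<Union>k\<in>I. S (int (M * k)))" using \<open>k \<in> I\<close> by blast
  qed
  have fS: "finite (S m)" and cS: "card (S m) \<le> 24 * g" for m
    using card_ordered_representations_le[OF B, of m] by (simp_all add: S_def fact_numeral)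
  have "card (divisible_quadruples X M) = card (f ` divisible_quadruples X M)"
    using \<open>inj f\<close> by (metis card_image inj_on_subset subset_UNIV)
  also have "\<dots> \<le> card (\<Union>k\<in>I. S (int (M * k)))"
    using sub fS by (intro card_mono) (auto simp: I_def)
  also have "\<dots> \<le> (\<Sum>k\<in>I. card (S (int (M * k))))" by (intro card_UN_le) (simp add: I_def)
  also have "\<dots> \<le> (\<Sum>k\<in>I. 24 * g)" by (intro sum_mono cS)
  also have "\<dots> = (4 * N ^ 4 div M) * (24 * g)" by (simp add: I_def)
  finally have "card (divisible_quadruples X M) \<le> (4 * N ^ 4 div M) * (24 * g)" .
  then have "real (card (divisible_quadruples X M)) \<le> real ((4 * N ^ 4 div M) * (24 * g))"
    by (simp only: of_nat_le_iff)
  also have "\<dots> = real (4 * N ^ 4 div M) * (24 * real g)"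
    by (simp only: of_nat_mult of_nat_numeral)
  also have "\<dots> \<le> (real (4 * N ^ 4) / real M) * (24 * real g)"
    by (intro mult_right_mono of_nat_div_le_of_nat) auto
  finally show ?thesis by (simp add: mult_ac)
qed

text \<open>
  Comparison of the lower and upper bounds for the number of divisible quadruples; the factor \<open>D ^ 4\<close>
  cancels.
\<close>
lemma block_length_le:
  assumes B: "is_B_set 4 g A" and X: "X \<subseteq> {1..N}" "X \<noteq> {}" "\<And>n. n \<in> X \<Longrightarrow> int n ^ 4 \<in> A"
    and L: "L \<ge> 1" and y: "y \<ge> 2" "y ^ (16 * L + 2) \<le> N"
    and large: "ln (ln (real y)) > real ((256 * L)\<^sup>2) + real L + 1 + 1152 * real L * real N / real (card X)"
  shows "real L \<le> 12288 * (real g * (real N / real (card X)) ^ 4)"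
proof -
  obtain P where P: "finite P" "card P = L" "\<And>p. p \<in> P \<Longrightarrow> prime p" "\<And>p. p \<in> P \<Longrightarrow> (256 * L)\<^sup>2 \<le> p"
    "\<And>p. p \<in> P \<Longrightarrow> defect X ((\<Prod>P) ^ 4) \<le> 1 / (384 * real p)"
    using exists_equidistributed_block[OF X(1,2) L y large] by metis
  interpret prime_block L P by unfold_locales (use P L in auto)
  have fX: "finite X" using X(1) finite_subset by blast
  have c0: "real (card X) > 0" using fX X(2) by (simp add: card_gt_0_iff)
  have D0: "real D > 0" using D_pos by simp
  have "real L * (real (card X) ^ 4 / (128 * real D ^ 4)) \<le> real (card (divisible_quadruples X (D ^ 4)))"
    using card_block_mult_le[OF fX X(2)] P(2,5) by (simp add: D_def)
  also have "\<dots> \<le> 96 * real g * real N ^ 4 / real (D ^ 4)"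
    using D_pos by (intro card_divisible_quadruples_le[OF B X(1) X(3)]) auto
  finally have "real L * real (card X) ^ 4 \<le> 12288 * (real g * real N ^ 4)"
    using D0 by (simp add: field_simps)
  then show ?thesis using c0 by (simp add: power_divide field_simps)
qed

text \<open>
  Choose \<open>L\<close> just too large for \<open>block_length_le\<close>. Then its hypotheses must fail for every \<open>y\<close>, and for \<open>y\<close>
  of size \<open>exp (exp s)\<close>, with \<open>s\<close> at most a constant times the square of \<open>g * (N / card X) ^ 4\<close>, this
  means that \<open>N\<close> is less than a moderate power of \<open>y\<close>.
\<close>
lemma ln_ln_le_density_power:
  assumes B: "is_B_set 4 g A" and g: "g \<ge> 1" and N: "N \<ge> 3"
    and X: "X \<subseteq> {1..N}" "X \<noteq> {}" "\<And>n. n \<in> X \<Longrightarrow> int n ^ 4 \<in> A"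
  shows "ln (ln (real N)) \<le> 10 ^ 14 * (real g * (real N / real (card X)) ^ 4)\<^sup>2"
proof (rule ccontr)
  assume neg: "\<not> ?thesis"
  define r where "r = real N / real (card X)"
  define G where "G = real g * r ^ 4"
  have fX: "finite X" using X(1) finite_subset by blast
  have c0: "real (card X) > 0" using fX X(2) by (simp add: card_gt_0_iff)
  have "card X \<le> N" using card_mono[OF _ X(1)] by simp
  then have r1: "r \<ge> 1" using c0 by (simp add: r_def)
  have "r ^ 4 \<ge> 1" using r1 by simp
  have rG: "r \<le> G"
  proof -
    have "r ^ 1 \<le> r ^ 4" using r1 by (intro power_increasing) auto
    also have "\<dots> = 1 * r ^ 4" by simp
    also have "\<dots> \<le> G" unfolding G_def using g r1 by (intro mult_right_mono) auto
    finally show ?thesis by simp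
  qed
  have G1: "G \<ge> 1" using rG r1 by linarith
  have GG: "G \<le> G * G" using G1 by (simp add: mult_le_cancel_left1)
  \<comment> \<open>The least length that contradicts \<open>block_length_le\<close>.\<close>
  define L where "L = nat \<lfloor>12288 * G\<rfloor> + 1"
  have L1: "L \<ge> 1" by (simp add: L_def)
  have L_eq: "real L = real_of_int \<lfloor>12288 * G\<rfloor> + 1" using G1 by (simp add: L_def)
  have L_gt: "real L > 12288 * G" using floor_correct[of "12288 * G"] L_eq by linarith
  have L_le: "real L \<le> 12289 * G"
  proof -
    have "real L \<le> 12288 * G + 1" using floor_correct[of "12288 * G"] L_eq by linarith
    then show ?thesis using G1 by linarith
  qed
  define s where "s = real ((256 * L)\<^sup>2) + real L + 2 + 1152 * real L * r"
  define y where "y = nat \<lceil>exp (exp s)\<rceil>"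
  have s2: "s \<ge> 2" unfolding s_def using r1 by simp
  have y_ge: "exp (exp s) \<le> real y" unfolding y_def by linarith
  have "exp s \<ge> 1" using s2 by simp
  then have "exp (exp s) \<ge> 1 + 1" using exp_ge_add_one_self[of "exp s"] by linarith
  then have y2: "y \<ge> 2" using y_ge by linarith
  have "0 \<le> \<lceil>exp (exp s)\<rceil>" using exp_ge_zero[of "exp s"] by linarith
  then have "real y = real_of_int \<lceil>exp (exp s)\<rceil>" by (simp add: y_def)
  then have y_le: "real y \<le> exp (exp s) + 1" using ceiling_correct[of "exp (exp s)"] by linarith
  have "ln (exp (exp s)) \<le> ln (real y)" using y_ge by (subst ln_le_cancel_iff) (use y2 in auto)
  then have "exp s \<le> ln (real y)" by simp
  then have "ln (exp s) \<le> ln (ln (real y))"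
    by (subst ln_le_cancel_iff) (use exp_gt_zero[of s] in linarith)+
  then have lnlny: "s \<le> ln (ln (real y))" by simp
  have "\<not> y ^ (16 * L + 2) \<le> N"
  proof
    assume "y ^ (16 * L + 2) \<le> N"
    then have "real L \<le> 12288 * G"
      using block_length_le[OF B X L1 y2] lnlny unfolding s_def G_def r_def by simp
    then show False using L_gt by linarith
  qed
  then have "N \<le> y ^ (16 * L + 2)" by simp
  then have "real N \<le> real y ^ (16 * L + 2)" by (metis of_nat_le_iff of_nat_power)
  then have "ln (real N) \<le> ln (real y ^ (16 * L + 2))"
    using N y2 by (subst ln_le_cancel_iff) auto
  also have "\<dots> = real (16 * L + 2) * ln (real y)" by (rule ln_realpow)
  also have "ln (real y) \<le> exp (s + 1)"
  proof -
    have "real y \<le> exp (exp s) + exp (exp s)" using y_le \<open>exp (exp s) \<ge> 1 + 1\<close> by linarith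
    also have "\<dots> = 2 * exp (exp s)" by simp
    also have "\<dots> \<le> exp 1 * exp (exp s)"
      using exp_ge_add_one_self[of "1 :: real"] by (intro mult_right_mono) auto
    also have "\<dots> = exp (1 + exp s)" by (simp add: exp_add)
    finally have "ln (real y) \<le> ln (exp (1 + exp s))" using y2 by (subst ln_le_cancel_iff) auto
    also have "\<dots> = 1 + exp s" by simp
    also have "\<dots> \<le> exp s + exp s" using \<open>exp s \<ge> 1\<close> by simp
    also have "\<dots> = 2 * exp s" by simp
    also have "\<dots> \<le> exp 1 * exp s"
      using exp_ge_add_one_self[of "1 :: real"] by (intro mult_right_mono) auto
    also have "\<dots> = exp (s + 1)" by (simp add: exp_add)
    finally show ?thesis .
  qed
  finally have lnN: "ln (real N) \<le> real (16 * L + 2) * exp (s + 1)" by (simp add: mult_left_mono)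
  have lnN0: "ln (real N) > 0" using N by simp
  have "ln (ln (real N)) \<le> ln (real (16 * L + 2) * exp (s + 1))"
    using lnN lnN0 by (subst ln_le_cancel_iff) (auto intro!: mult_pos_pos)
  also have "\<dots> = ln (real (16 * L + 2)) + (s + 1)" by (subst ln_mult) auto
  also have "ln (real (16 * L + 2)) \<le> real (16 * L + 2) - 1" by (intro ln_le_minus_one) simp
  also have "real (16 * L + 2) - 1 + (s + 1) = 65536 * (real L * real L) + 17 * real L + 4 + 1152 * (real L * r)"
    by (simp add: s_def power2_eq_square)
  also have "\<dots> \<le> 65536 * (12289 * 12289 * (G * G)) + 17 * (12289 * (G * G)) + 4 * (G * G) + 1152 * (12289 * (G * G))"
  proof (intro add_mono mult_left_mono)
    have "real L * real L \<le> (12289 * G) * (12289 * G)" using L_le G1 by (intro mult_mono) auto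
    then show "real L * real L \<le> 12289 * 12289 * (G * G)" by simp
    show "real L \<le> 12289 * (G * G)" using L_le GG by linarith
    show "4 \<le> 4 * (G * G)" using GG G1 by linarith
    have "real L * r \<le> (12289 * G) * G" using L_le rG G1 r1 by (intro mult_mono) auto
    then show "real L * r \<le> 12289 * (G * G)" by simp
  qed auto
  also have "\<dots> = (65536 * (12289 * 12289) + 17 * 12289 + 4 + 1152 * 12289) * (G * G)" by simp
  also have "\<dots> \<le> 10 ^ 14 * (G * G)" using G1 by (intro mult_right_mono) auto
  finally show False using neg by (simp add: G_def r_def power2_eq_square)
qed

section \<open>The density bound\<close>

theorem theorem1p8:
  "\<exists>c>0. \<exists>C>0. \<forall>(N::nat) (g::nat) (A::int set).
     N \<ge> 3 \<longrightarrow> g \<ge> 1 \<longrightarrow> A \<subseteq> (\<lambda>n. int n ^ 4) ` {1..N} \<longrightarrow> is_B_set 4 g A \<longrightarrow>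
     real (card A) \<le> C * (real g powr (1/16) * real N / (ln (ln (real N))) powr c)"
proof -
  define K :: real where "K = 10 ^ 14"
  have K: "K > 0" by (simp add: K_def)
  have "real (card A) \<le> K powr (1/32) * (real g powr (1/16) * real N / (ln (ln (real N))) powr (1/32))"
    if N: "N \<ge> 3" and g: "g \<ge> 1" and A: "A \<subseteq> (\<lambda>n. int n ^ 4) ` {1..N}" and B: "is_B_set 4 g A" for N g A
  proof (cases "A = {}")
    case True
    then show ?thesis by simp
  next
    case False
    define X where "X = {n \<in> {1..N}. int n ^ 4 \<in> A}"
    have X: "X \<subseteq> {1..N}" "\<And>n. n \<in> X \<Longrightarrow> int n ^ 4 \<in> A" by (auto simp: X_def)
    have img: "A = (\<lambda>n. int n ^ 4) ` X" using A by (auto simp: X_def)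
    have "X \<noteq> {}" using img False by blast
    have "inj_on (\<lambda>n. int n ^ 4) X"
    proof (rule inj_onI)
      fix a b assume "int a ^ 4 = int b ^ 4"
      from power_eq_imp_eq_base[OF this] show "a = b" by simp
    qed
    then have card_eq: "card A = card X" unfolding img by (rule card_image)
    define \<delta> where "\<delta> = real (card X) / real N"
    define l where "l = ln (ln (real N))"
    have c0: "real (card X) > 0" using \<open>X \<noteq> {}\<close> finite_subset[OF X(1)] by (simp add: card_gt_0_iff)
    have N0: "real N > 0" using N by simp
    have \<delta>0: "\<delta> > 0" using c0 N0 by (simp add: \<delta>_def)
    have \<delta>1: "\<delta> \<le> 1" using card_mono[OF _ X(1)] N0 by (simp add: \<delta>_def)
    have l0: "l > 0"
    proof -
      have "exp 1 < real N" using e_less_272 N by linarith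
      then have "ln (exp 1) < ln (real N)" using N0 by (subst ln_less_cancel_iff) auto
      then show ?thesis by (simp add: l_def)
    qed
    have "l \<le> K * (real g * (real N / real (card X)) ^ 4)\<^sup>2"
      unfolding l_def K_def by (rule ln_ln_le_density_power[OF B g N X(1) \<open>X \<noteq> {}\<close> X(2)])
    also have "real N / real (card X) = 1 / \<delta>" by (simp add: \<delta>_def)
    also have "K * (real g * (1 / \<delta>) ^ 4)\<^sup>2 = K * real g ^ 2 / \<delta> ^ 8"
      by (simp add: power_mult_distrib power_divide flip: power_mult)
    finally have "\<delta> ^ 8 \<le> K * real g ^ 2 / l"
      using \<delta>0 l0 by (simp add: field_simps)
    \<comment> \<open>Giving away powers of the density \<open>\<delta> \<le> 1\<close> turns \<open>g\<^sup>2\<close> into the exponent \<open>1/16\<close> of \<open>g\<close>.\<close>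
    moreover have "\<delta> ^ 32 \<le> \<delta> ^ 8" using \<delta>0 \<delta>1 by (intro power_decreasing) auto
    ultimately have "\<delta> ^ 32 \<le> K * real g ^ 2 / l" by linarith
    then have "(\<delta> ^ 32) powr (1/32) \<le> (K * real g ^ 2 / l) powr (1/32)"
      using \<delta>0 by (intro powr_mono2) auto
    also have "(\<delta> ^ 32) powr (1/32) = \<delta>"
    proof -
      have "\<delta> ^ 32 = \<delta> powr 32" using powr_realpow[OF \<delta>0, of 32] by simp
      then show ?thesis using \<delta>0 by (simp only: powr_powr) simp
    qed
    also have "(K * real g ^ 2 / l) powr (1/32) = K powr (1/32) * (real g ^ 2) powr (1/32) / l powr (1/32)"
      using K l0 by (simp add: powr_mult powr_divide)
    also have "(real g ^ 2) powr (1/32) = real g powr (1/16)"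
    proof -
      have "real g ^ 2 = real g powr 2" using powr_realpow[of "real g" 2] g by simp
      then show ?thesis by (simp only: powr_powr) simp
    qed
    finally have "\<delta> * real N \<le> K powr (1/32) * real g powr (1/16) / l powr (1/32) * real N"
      using N0 by (intro mult_right_mono) auto
    then show ?thesis using N0 by (simp add: card_eq \<delta>_def l_def mult_ac)
  qed
  then show ?thesis using K by (intro exI[of _ "1/32"] exI[of _ "K powr (1/32)"] conjI allI impI) auto
qed

end
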